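(* Let $k$ be an algebraically closed field of characteristic zero, and let $r, n$ be positive integers with $n \geq 3$. There exists a surjective homomorphism of $k$-algebras $\mathcal{U}(\mathfrak{ym}(n)) \twoheadrightarrow A_r(k)$. Furthermore, there exists $l \in \mathbb{N}$ such that this homomorphism can be chosen so that it factors through the quotient $\mathcal{U}(\mathfrak{ym}(n)/\mathcal{C}^l(\mathfrak{ym}(n)))$, i.e. so that it is the composition of the canonical surjection $\mathcal{U}(\mathfrak{ym}(n)) \twoheadrightarrow \mathcal{U}(\mathfrak{ym}(n)/\mathcal{C}^l(\mathfrak{ym}(n)))$ with a surjective homomorphism of $k$-algebras $\mathcal{U}(\mathfrak{ym}(n)/\mathcal{C}^l(\mathfrak{ym}(n))) \twoheadrightarrow A_r(k)$.
   Context: For an integer $n \geq 2$, let $\mathfrak{f}(n)$ be the free Lie algebra over $k$ on generators $x_1,\dots,x_n$. The Lie Yang-Mills algebra is the quotient $\mathfrak{ym}(n) = \mathfrak{f}(n)/\langle \sum_{i=1}^n [x_i,[x_i,x_j]] : 1 \leq j \leq n\rangle$ by the Lie ideal generated by the indicated elements. $\mathcal{U}(\mathfrak{g})$ denotes the universal enveloping algebra of a Lie algebra $\mathfrak{g}$. The lower central series of $\mathfrak{g}$ is $\mathcal{C}^0(\mathfrak{g})=\mathfrak{g}$, $\mathcal{C}^{m+1}(\mathfrak{g}) = [\mathfrak{g},\mathcal{C}^m(\mathfrak{g})]$. $A_r(k)$ is the $r$-th Weyl algebra, generated by $p_1,\dots,p_r,q_1,\dots,q_r$ with the canonical commutation relations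 ($[p_i,q_j]=\delta_{ij}$, $[p_i,p_j]=[q_i,q_j]=0$). $\mathbb{N}$ denotes the positive integers. *)

theory Defs
  imports "HOL-Algebra.Algebraic_Closure"
begin

section \<open>Algebras over a field, their quotients and homomorphisms\<close>

text \<open>
  A \<open>K\<close>-algebra, not necessarily associative or unital, is a module record over \<open>K\<close> whose
  \<open>mult\<close> field is the product.  A Lie algebra is such a record in which
  \<open>x \<otimes>\<^bsub>L\<^esub> y\<close> is the bracket \<open>[x, y]\<close>; its field \<open>one\<close> has no meaning.
\<close>

text \<open>
  The library's \<^const>\<open>ideal\<close> presupposes an associative unital ring, so two-sided ideals of
  general algebras (in particular Lie ideals) are introduced separately.
\<close>

definition algebra_ideal :: "('k, 'm) ring_scheme \<Rightarrow> ('k, 'a) module \<Rightarrow> 'a set \<Rightarrow> bool"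
  where "algebra_ideal K A I \<longleftrightarrow> submodule I K A \<and>
    (\<forall>a\<in>I. \<forall>x\<in>carrier A. x \<otimes>\<^bsub>A\<^esub> a \<in> I \<and> a \<otimes>\<^bsub>A\<^esub> x \<in> I)"

text \<open>
  \<^const>\<open>FactRing\<close> only consists of cosets and operations on them, so it makes sense for
  non-associative products as well; only the scalar action has to be added.
\<close>

definition quotient_algebra :: "('k, 'a) module \<Rightarrow> 'a set \<Rightarrow> ('k, 'a set) module"
  where "quotient_algebra A I =
    ring.extend (A Quot I)
      (module.fields (\<lambda>c C. \<Union>x\<in>C. I +>\<^bsub>A\<^esub> (c \<odot>\<^bsub>A\<^esub> x)))"

definition algebra_hom ::
  "('k, 'm) ring_scheme \<Rightarrow> ('k, 'a) module \<Rightarrow> ('k, 'b) module \<Rightarrow> ('a \<Rightarrow> 'b) set"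
  where "algebra_hom K A B = {h \<in> ring_hom A B.
    \<forall>c\<in>carrier K. \<forall>x\<in>carrier A. h (c \<odot>\<^bsub>A\<^esub> x) = c \<odot>\<^bsub>B\<^esub> h x}"

section \<open>Free Lie algebras and the Yang--Mills Lie algebra\<close>

text \<open>
  The free non-associative algebra on \<open>S\<close> has as basis the free magma on \<open>S\<close>; its elements are
  the finitely supported functions from the magma to \<open>K\<close>.  The free Lie algebra is its quotient
  by the ideal generated by all squares and all Jacobi sums (Bourbaki's construction).
\<close>

datatype 'x magma_word = Leaf 'x | Node "'x magma_word" "'x magma_word"

definition basis_elem :: "('k, 'm) ring_scheme \<Rightarrow> 'w \<Rightarrow> 'w \<Rightarrow> 'k"
  where "basis_elem K w = (\<lambda>v. if v = w then \<one>\<^bsub>K\<^esub> else \<zero>\<^bsub>K\<^esub>)"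

definition free_nonassoc :: "('k, 'm) ring_scheme \<Rightarrow> 'x set \<Rightarrow> ('k, 'x magma_word \<Rightarrow> 'k) module"
  where "free_nonassoc K S =
    \<lparr>carrier = {f. range f \<subseteq> carrier K \<and> finite {t. f t \<noteq> \<zero>\<^bsub>K\<^esub>} \<and>
                  (\<forall>t. f t \<noteq> \<zero>\<^bsub>K\<^esub> \<longrightarrow> set_magma_word t \<subseteq> S)},
     monoid.mult = (\<lambda>f g t. case t of Leaf x \<Rightarrow> \<zero>\<^bsub>K\<^esub> | Node s u \<Rightarrow> f s \<otimes>\<^bsub>K\<^esub> g u),
     one = (\<lambda>t. \<zero>\<^bsub>K\<^esub>),
     zero = (\<lambda>t. \<zero>\<^bsub>K\<^esub>),
     add = (\<lambda>f g t. f t \<oplus>\<^bsub>K\<^esub> g t),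
     smult = (\<lambda>c f t. c \<otimes>\<^bsub>K\<^esub> f t)\<rparr>"

definition lie_relators :: "('k, 'a) module \<Rightarrow> 'a set"
  where "lie_relators A = {a \<otimes>\<^bsub>A\<^esub> a | a. a \<in> carrier A} \<union>
    {a \<otimes>\<^bsub>A\<^esub> (b \<otimes>\<^bsub>A\<^esub> c) \<oplus>\<^bsub>A\<^esub> b \<otimes>\<^bsub>A\<^esub> (c \<otimes>\<^bsub>A\<^esub> a) \<oplus>\<^bsub>A\<^esub> c \<otimes>\<^bsub>A\<^esub> (a \<otimes>\<^bsub>A\<^esub> b) | a b c.
       a \<in> carrier A \<and> b \<in> carrier A \<and> c \<in> carrier A}"

definition free_lie_ideal :: "('k, 'm) ring_scheme \<Rightarrow> 'x set \<Rightarrow> ('x magma_word \<Rightarrow> 'k) set"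
  where "free_lie_ideal K S =
    algebra_ideal K (free_nonassoc K S) hull lie_relators (free_nonassoc K S)"

definition free_lie :: "('k, 'm) ring_scheme \<Rightarrow> 'x set \<Rightarrow> ('k, ('x magma_word \<Rightarrow> 'k) set) module"
  where "free_lie K S = quotient_algebra (free_nonassoc K S) (free_lie_ideal K S)"

definition free_lie_gen :: "('k, 'm) ring_scheme \<Rightarrow> 'x set \<Rightarrow> 'x \<Rightarrow> ('x magma_word \<Rightarrow> 'k) set"
  where "free_lie_gen K S x = free_lie_ideal K S +>\<^bsub>free_nonassoc K S\<^esub> basis_elem K (Leaf x)"

definition yang_mills_relators ::
  "('k, 'm) ring_scheme \<Rightarrow> nat \<Rightarrow> (nat magma_word \<Rightarrow> 'k) set set"
  where "yang_mills_relators K n =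
    (let F = free_lie K {1..n}; x = free_lie_gen K {1..n}
     in {\<Oplus>\<^bsub>F\<^esub>i\<in>{1..n}. x i \<otimes>\<^bsub>F\<^esub> (x i \<otimes>\<^bsub>F\<^esub> x j) | j. j \<in> {1..n}})"

definition yang_mills ::
  "('k, 'm) ring_scheme \<Rightarrow> nat \<Rightarrow> ('k, (nat magma_word \<Rightarrow> 'k) set set) module"
  where "yang_mills K n = quotient_algebra (free_lie K {1..n})
    (algebra_ideal K (free_lie K {1..n}) hull yang_mills_relators K n)"

text \<open>\<open>[L, C]\<close> denotes the linear span of the brackets, not just the set of brackets.\<close>

primrec lower_central :: "('k, 'm) ring_scheme \<Rightarrow> ('k, 'a) module \<Rightarrow> nat \<Rightarrow> 'a set"
  where
    "lower_central K L 0 = carrier L"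
  | "lower_central K L (Suc m) = (\<lambda>H. submodule H K L) hull
       {x \<otimes>\<^bsub>L\<^esub> y | x y. x \<in> carrier L \<and> y \<in> lower_central K L m}"

section \<open>Free associative algebras, enveloping algebras and Weyl algebras\<close>

definition free_algebra :: "('k, 'm) ring_scheme \<Rightarrow> 'x set \<Rightarrow> ('k, 'x list \<Rightarrow> 'k) module"
  where "free_algebra K S =
    \<lparr>carrier = {f. range f \<subseteq> carrier K \<and> finite {w. f w \<noteq> \<zero>\<^bsub>K\<^esub>} \<and>
                  (\<forall>w. f w \<noteq> \<zero>\<^bsub>K\<^esub> \<longrightarrow> set w \<subseteq> S)},
     monoid.mult = (\<lambda>f g w. \<Oplus>\<^bsub>K\<^esub>i\<in>{..length w}. f (take i w) \<otimes>\<^bsub>K\<^esub> g (drop i w)),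
     one = basis_elem K [],
     zero = (\<lambda>w. \<zero>\<^bsub>K\<^esub>),
     add = (\<lambda>f g w. f w \<oplus>\<^bsub>K\<^esub> g w),
     smult = (\<lambda>c f w. c \<otimes>\<^bsub>K\<^esub> f w)\<rparr>"

text \<open>The homomorphism from \<open>free_algebra K S\<close> to \<open>B\<close> that sends each generator \<open>x\<close> to \<open>f x\<close>.\<close>

definition free_algebra_lift ::
  "('k, 'm) ring_scheme \<Rightarrow> ('k, 'b) module \<Rightarrow> ('x \<Rightarrow> 'b) \<Rightarrow> ('x list \<Rightarrow> 'k) \<Rightarrow> 'b"
  where "free_algebra_lift K B f a =
    (\<Oplus>\<^bsub>B\<^esub>w\<in>{w. a w \<noteq> \<zero>\<^bsub>K\<^esub>}. a w \<odot>\<^bsub>B\<^esub> foldr (\<lambda>x b. f x \<otimes>\<^bsub>B\<^esub> b) w \<one>\<^bsub>B\<^esub>)"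

text \<open>
  The first two families of relators turn the free algebra on the set \<open>carrier L\<close> into the
  tensor algebra of the vector space \<open>L\<close>.
\<close>

definition enveloping_relators :: "('k, 'm) ring_scheme \<Rightarrow> ('k, 'a) module \<Rightarrow> ('a list \<Rightarrow> 'k) set"
  where "enveloping_relators K L =
    (let T = free_algebra K (carrier L); v = (\<lambda>x. basis_elem K [x])
     in {v (x \<oplus>\<^bsub>L\<^esub> y) \<ominus>\<^bsub>T\<^esub> (v x \<oplus>\<^bsub>T\<^esub> v y) | x y. x \<in> carrier L \<and> y \<in> carrier L} \<union>
        {v (c \<odot>\<^bsub>L\<^esub> x) \<ominus>\<^bsub>T\<^esub> c \<odot>\<^bsub>T\<^esub> v x | c x. c \<in> carrier K \<and> x \<in> carrier L} \<union>
        {(v x \<otimes>\<^bsub>T\<^esub> v y \<ominus>\<^bsub>T\<^esub> v y \<otimes>\<^bsub>T\<^esub> v x) \<ominus>\<^bsub>T\<^esub> v (x \<otimes>\<^bsub>L\<^esub> y) | x y.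
           x \<in> carrier L \<and> y \<in> carrier L})"

definition enveloping_ideal :: "('k, 'm) ring_scheme \<Rightarrow> ('k, 'a) module \<Rightarrow> ('a list \<Rightarrow> 'k) set"
  where "enveloping_ideal K L = Idl\<^bsub>free_algebra K (carrier L)\<^esub> (enveloping_relators K L)"

definition enveloping :: "('k, 'm) ring_scheme \<Rightarrow> ('k, 'a) module \<Rightarrow> ('k, ('a list \<Rightarrow> 'k) set) module"
  where "enveloping K L = quotient_algebra (free_algebra K (carrier L)) (enveloping_ideal K L)"

definition enveloping_incl ::
  "('k, 'm) ring_scheme \<Rightarrow> ('k, 'a) module \<Rightarrow> 'a \<Rightarrow> ('a list \<Rightarrow> 'k) set"
  where "enveloping_incl K L x =
    enveloping_ideal K L +>\<^bsub>free_algebra K (carrier L)\<^esub> basis_elem K [x]"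

text \<open>
  The homomorphism from \<open>enveloping K L\<close> to \<open>B\<close> induced by a Lie homomorphism \<open>f\<close> from \<open>L\<close> to
  \<open>B\<close> with the commutator bracket.  For such \<open>f\<close>, \<^const>\<open>free_algebra_lift\<close> is constant on each
  coset \<open>Z\<close>, so the image below is a singleton.
\<close>

definition enveloping_lift ::
  "('k, 'm) ring_scheme \<Rightarrow> ('k, 'b) module \<Rightarrow> ('a \<Rightarrow> 'b) \<Rightarrow> ('a list \<Rightarrow> 'k) set \<Rightarrow> 'b"
  where "enveloping_lift K B f Z = the_elem (free_algebra_lift K B f ` Z)"

text \<open>The canonical surjection from \<open>U(L)\<close> onto \<open>U(L/I)\<close>, induced by the projection of \<open>L\<close> onto \<open>L/I\<close>.\<close>

definition enveloping_proj ::
  "('k, 'm) ring_scheme \<Rightarrow> ('k, 'a) module \<Rightarrow> 'a set \<Rightarrow> ('a list \<Rightarrow> 'k) set \<Rightarrow> ('a set list \<Rightarrow> 'k) set"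
  where "enveloping_proj K L I =
    enveloping_lift K (enveloping K (quotient_algebra L I))
      (\<lambda>x. enveloping_incl K (quotient_algebra L I) (I +>\<^bsub>L\<^esub> x))"

datatype weyl_gen = P nat | Q nat

definition weyl_gens :: "nat \<Rightarrow> weyl_gen set"
  where "weyl_gens r = P ` {1..r} \<union> Q ` {1..r}"

definition weyl_relators :: "('k, 'm) ring_scheme \<Rightarrow> nat \<Rightarrow> (weyl_gen list \<Rightarrow> 'k) set"
  where "weyl_relators K r =
    (let T = free_algebra K (weyl_gens r);
         p = (\<lambda>i. basis_elem K [P i]); q = (\<lambda>i. basis_elem K [Q i]);
         comm = (\<lambda>a b. a \<otimes>\<^bsub>T\<^esub> b \<ominus>\<^bsub>T\<^esub> b \<otimes>\<^bsub>T\<^esub> a)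
     in {comm (p i) (q j) \<ominus>\<^bsub>T\<^esub> (if i = j then \<one>\<^bsub>T\<^esub> else \<zero>\<^bsub>T\<^esub>) | i j. i \<in> {1..r} \<and> j \<in> {1..r}} \<union>
        {comm (p i) (p j) | i j. i \<in> {1..r} \<and> j \<in> {1..r}} \<union>
        {comm (q i) (q j) | i j. i \<in> {1..r} \<and> j \<in> {1..r}})"

definition weyl_algebra :: "('k, 'm) ring_scheme \<Rightarrow> nat \<Rightarrow> ('k, (weyl_gen list \<Rightarrow> 'k) set) module"
  where "weyl_algebra K r = quotient_algebra (free_algebra K (weyl_gens r))
    (Idl\<^bsub>free_algebra K (weyl_gens r)\<^esub> (weyl_relators K r))"

end

theory Submission
  imports Defs
begin

text \<open>
  A homomorphism of algebras from \<open>U(ym(n))\<close> to \<open>A\<^sub>r\<close> is the same as a family of elements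
  \<open>a\<^sub>1, \<dots>, a\<^sub>n\<close> of \<open>A\<^sub>r\<close> with \<open>\<Sum>\<^sub>i [a\<^sub>i, [a\<^sub>i, a\<^sub>j]] = 0\<close> for all \<open>j\<close>.  It is onto if these elements
  generate \<open>A\<^sub>r\<close>, and it factors through \<open>U(ym(n)/C\<^sup>l)\<close> if the Lie algebra that they generate is
  nilpotent and \<open>l\<close> is large enough.

  Since \<open>k\<close> contains a square root \<open>\<iota>\<close> of \<open>-1\<close>, the family \<open>a, x, \<iota>x, 0, \<dots>, 0\<close> solves the equations as
  soon as \<open>[a, [a, x]] = 0\<close>: the contributions of \<open>x\<close> and \<open>\<iota>x\<close> cancel because \<open>1 + \<iota>\<^sup>2 = 0\<close>
  (\<open>yang_mills_solution\<close>).  So two elements \<open>a\<close> and \<open>x\<close> are enough.  For \<open>r \<ge> 2\<close> take \<open>a = q\<^sub>1\<close> and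
  \<open>x = q\<^sub>2p\<^sub>1 + \<dots> + q\<^sub>rp\<^bsub>r-1\<^esub> + p\<^sub>r\<^sup>2\<close>.  Bracketing with \<open>x\<close> moves, up to nonzero scalars, along the chain
  \<open>q\<^sub>1 \<rightarrow> q\<^sub>2 \<rightarrow> \<dots> \<rightarrow> q\<^sub>r \<rightarrow> p\<^sub>r \<rightarrow> \<dots> \<rightarrow> p\<^sub>1 \<rightarrow> 0\<close>,
  so that \<open>[a, [a, x]]\<close> is a multiple of \<open>[q\<^sub>1, q\<^sub>2] = 0\<close>, and \<open>a\<close> and \<open>x\<close> generate \<open>A\<^sub>r\<close>
  (\<open>weyl_generators_mem\<close>).  For \<open>r = 1\<close> the elements \<open>q\<^sub>1\<close> and \<open>x = p\<^sub>1\<close> do.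

  The generated Lie algebra lies in the span of \<open>x\<close>, the chain and \<open>1\<close>.  In this order the bracket
  of any two of these elements is a multiple of a later one (\<open>chain_triangular\<close>), so the spans of the
  tails form a filtration that the lower central series descends (\<open>triangular_filtration\<close>,
  \<open>lower_central_image\<close>).  There are \<open>2r + 2\<close> elements, whence \<open>l = 2r + 2\<close>.

  These computations take place in any algebra with elements \<open>p\<^sub>i\<close> and \<open>q\<^sub>i\<close> that satisfy the relations
  of \<open>A\<^sub>r\<close>.  The rest consists of the universal properties of the algebras involved, which are all
  quotients of modules of finitely supported functions.
\<close>

section \<open>Algebras, quotients and homomorphisms\<close>

text \<open>
  Lie algebras and the free non-associative algebra occur along with the associative algebras, so
  quotients and homomorphisms are treated for an arbitrary bilinear product.
\<close>

locale nonassoc_algebra = module K A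
  for K :: "('k, 'm) ring_scheme" and A :: "('k, 'a) module" +
  assumes mult_closed [simp, intro]:
      "\<lbrakk>x \<in> carrier A; y \<in> carrier A\<rbrakk> \<Longrightarrow> x \<otimes>\<^bsub>A\<^esub> y \<in> carrier A"
    and mult_add_left:
      "\<lbrakk>x \<in> carrier A; y \<in> carrier A; z \<in> carrier A\<rbrakk> \<Longrightarrow> (x \<oplus>\<^bsub>A\<^esub> y) \<otimes>\<^bsub>A\<^esub> z = x \<otimes>\<^bsub>A\<^esub> z \<oplus>\<^bsub>A\<^esub> y \<otimes>\<^bsub>A\<^esub> z"
    and mult_add_right:
      "\<lbrakk>x \<in> carrier A; y \<in> carrier A; z \<in> carrier A\<rbrakk> \<Longrightarrow> z \<otimes>\<^bsub>A\<^esub> (x \<oplus>\<^bsub>A\<^esub> y) = z \<otimes>\<^bsub>A\<^esub> x \<oplus>\<^bsub>A\<^esub> z \<otimes>\<^bsub>A\<^esub> y"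
    and mult_smult_left:
      "\<lbrakk>c \<in> carrier K; x \<in> carrier A; y \<in> carrier A\<rbrakk> \<Longrightarrow> (c \<odot>\<^bsub>A\<^esub> x) \<otimes>\<^bsub>A\<^esub> y = c \<odot>\<^bsub>A\<^esub> (x \<otimes>\<^bsub>A\<^esub> y)"
    and mult_smult_right:
      "\<lbrakk>c \<in> carrier K; x \<in> carrier A; y \<in> carrier A\<rbrakk> \<Longrightarrow> x \<otimes>\<^bsub>A\<^esub> (c \<odot>\<^bsub>A\<^esub> y) = c \<odot>\<^bsub>A\<^esub> (x \<otimes>\<^bsub>A\<^esub> y)"
begin

lemma mult_zero_left [simp]: "x \<in> carrier A \<Longrightarrow> \<zero>\<^bsub>A\<^esub> \<otimes>\<^bsub>A\<^esub> x = \<zero>\<^bsub>A\<^esub>"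
  using mult_smult_left[of "\<zero>\<^bsub>K\<^esub>" "\<zero>\<^bsub>A\<^esub>" x] by simp

lemma mult_zero_right [simp]: "x \<in> carrier A \<Longrightarrow> x \<otimes>\<^bsub>A\<^esub> \<zero>\<^bsub>A\<^esub> = \<zero>\<^bsub>A\<^esub>"
  using mult_smult_right[of "\<zero>\<^bsub>K\<^esub>" x "\<zero>\<^bsub>A\<^esub>"] by simp

lemma smult_neg_one: "x \<in> carrier A \<Longrightarrow> (\<ominus>\<^bsub>K\<^esub> \<one>\<^bsub>K\<^esub>) \<odot>\<^bsub>A\<^esub> x = \<ominus>\<^bsub>A\<^esub> x"
  by (simp add: smult_l_minus)

lemma minus_self: "x \<in> carrier A \<Longrightarrow> x \<ominus>\<^bsub>A\<^esub> x = \<zero>\<^bsub>A\<^esub>"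
  by (simp add: a_minus_def M.r_neg)

lemma algebra_idealD:
  assumes "algebra_ideal K A I"
  shows "I \<subseteq> carrier A" "\<zero>\<^bsub>A\<^esub> \<in> I"
    and "\<And>a b. \<lbrakk>a \<in> I; b \<in> I\<rbrakk> \<Longrightarrow> a \<oplus>\<^bsub>A\<^esub> b \<in> I"
    and "\<And>c a. \<lbrakk>c \<in> carrier K; a \<in> I\<rbrakk> \<Longrightarrow> c \<odot>\<^bsub>A\<^esub> a \<in> I"
    and "\<And>a. a \<in> I \<Longrightarrow> \<ominus>\<^bsub>A\<^esub> a \<in> I"
    and "\<And>a x. \<lbrakk>a \<in> I; x \<in> carrier A\<rbrakk> \<Longrightarrow> x \<otimes>\<^bsub>A\<^esub> a \<in> I"
    and "\<And>a x. \<lbrakk>a \<in> I; x \<in> carrier A\<rbrakk> \<Longrightarrow> a \<otimes>\<^bsub>A\<^esub> x \<in> I"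
proof -
  have S: "submodule I K A" using assms by (simp add: algebra_ideal_def)
  note E = submoduleE[OF S]
  show "I \<subseteq> carrier A" "\<And>a b. \<lbrakk>a \<in> I; b \<in> I\<rbrakk> \<Longrightarrow> a \<oplus>\<^bsub>A\<^esub> b \<in> I"
    "\<And>c a. \<lbrakk>c \<in> carrier K; a \<in> I\<rbrakk> \<Longrightarrow> c \<odot>\<^bsub>A\<^esub> a \<in> I" "\<And>a. a \<in> I \<Longrightarrow> \<ominus>\<^bsub>A\<^esub> a \<in> I"
    using E by auto
  show "\<zero>\<^bsub>A\<^esub> \<in> I"
    using subgroup.one_closed[OF submodule.axioms(1)[OF S]] by simp
  show "\<And>a x. \<lbrakk>a \<in> I; x \<in> carrier A\<rbrakk> \<Longrightarrow> x \<otimes>\<^bsub>A\<^esub> a \<in> I"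
    "\<And>a x. \<lbrakk>a \<in> I; x \<in> carrier A\<rbrakk> \<Longrightarrow> a \<otimes>\<^bsub>A\<^esub> x \<in> I"
    using assms by (auto simp: algebra_ideal_def)
qed

lemma submodule_closedI:
  assumes "H \<subseteq> carrier A" "\<zero>\<^bsub>A\<^esub> \<in> H"
    and "\<And>a b. \<lbrakk>a \<in> H; b \<in> H\<rbrakk> \<Longrightarrow> a \<oplus>\<^bsub>A\<^esub> b \<in> H"
    and "\<And>c a. \<lbrakk>c \<in> carrier K; a \<in> H\<rbrakk> \<Longrightarrow> c \<odot>\<^bsub>A\<^esub> a \<in> H"
  shows "submodule H K A"
proof (rule submoduleI)
  fix a assume "a \<in> H"
  then show "\<ominus>\<^bsub>A\<^esub> a \<in> H"
    using assms(4)[of "\<ominus>\<^bsub>K\<^esub> \<one>\<^bsub>K\<^esub>" a] smult_neg_one[of a] assms(1) by auto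
qed (use assms in auto)

text \<open>
  The family must be nonempty: the intersection of the empty family is \<^const>\<open>UNIV\<close>, which need not
  be a submodule.  For the same reason the general facts on \<^const>\<open>hull\<close> do not apply below, and
  the carrier has to be exhibited as a member of the family.
\<close>

lemma submodule_Inter:
  assumes "\<And>H. H \<in> F \<Longrightarrow> submodule H K A" "F \<noteq> {}"
  shows "submodule (\<Inter>F) K A"
proof (rule submodule_closedI)
  show "\<Inter>F \<subseteq> carrier A"
    using assms submoduleE(1) by (meson Inter_lower all_not_in_conv order_trans)
  show "\<zero>\<^bsub>A\<^esub> \<in> \<Inter>F"
    using assms subgroup.one_closed[OF submodule.axioms(1)] by fastforce
qed (use assms submoduleE(4,5) in \<open>auto; blast\<close>)+

lemma submodule_hull:
  assumes "S \<subseteq> carrier A"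
  shows "submodule ((\<lambda>H. submodule H K A) hull S) K A"
  unfolding hull_def
  by (rule submodule_Inter) (use assms carrier_is_submodule in auto)

lemma algebra_ideal_hull:
  assumes "S \<subseteq> carrier A"
  shows "algebra_ideal K A (algebra_ideal K A hull S)"
proof -
  have "algebra_ideal K A (carrier A)"
    using carrier_is_submodule by (auto simp: algebra_ideal_def)
  then have "submodule (\<Inter>{t. algebra_ideal K A t \<and> S \<subseteq> t}) K A"
    by (intro submodule_Inter) (use assms in \<open>auto simp: algebra_ideal_def\<close>)
  then show ?thesis
    by (auto simp: hull_def algebra_ideal_def)
qed

end

text \<open>
  All the axioms are identities, so they pass to surjective images; this spares verifying them on
  cosets.
\<close>

lemma nonassoc_algebra_surj_image:
  assumes A: "nonassoc_algebra K A"
    and surj: "\<pi> ` carrier A = carrier B"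
    and zero: "\<pi> \<zero>\<^bsub>A\<^esub> = \<zero>\<^bsub>B\<^esub>"
    and add: "\<And>x y. \<lbrakk>x \<in> carrier A; y \<in> carrier A\<rbrakk> \<Longrightarrow> \<pi> (x \<oplus>\<^bsub>A\<^esub> y) = \<pi> x \<oplus>\<^bsub>B\<^esub> \<pi> y"
    and smult: "\<And>c x. \<lbrakk>c \<in> carrier K; x \<in> carrier A\<rbrakk> \<Longrightarrow> \<pi> (c \<odot>\<^bsub>A\<^esub> x) = c \<odot>\<^bsub>B\<^esub> \<pi> x"
    and mult: "\<And>x y. \<lbrakk>x \<in> carrier A; y \<in> carrier A\<rbrakk> \<Longrightarrow> \<pi> (x \<otimes>\<^bsub>A\<^esub> y) = \<pi> x \<otimes>\<^bsub>B\<^esub> \<pi> y"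
  shows "nonassoc_algebra K B"
proof -
  interpret A: nonassoc_algebra K A by (rule A)
  have ex: "\<exists>a\<in>carrier A. x = \<pi> a" if "x \<in> carrier B" for x
    using that surj by auto
  have cl: "\<pi> a \<in> carrier B" if "a \<in> carrier A" for a
    using that surj by auto
  note eqs = add[symmetric] smult[symmetric] mult[symmetric] zero[symmetric] cl
  have "abelian_group B"
  proof (rule abelian_groupI)
    fix x assume "x \<in> carrier B"
    then obtain a where "a \<in> carrier A" "x = \<pi> a" using ex by blast
    then show "\<exists>y\<in>carrier B. y \<oplus>\<^bsub>B\<^esub> x = \<zero>\<^bsub>B\<^esub>"
      by (intro bexI[of _ "\<pi> (\<ominus>\<^bsub>A\<^esub> a)"]) (auto simp: eqs A.M.l_neg)
  qed (auto dest!: ex simp: eqs A.M.a_ac)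
  moreover have "module_axioms K B"
    by unfold_locales (auto dest!: ex simp: eqs A.smult_l_distr A.smult_r_distr A.smult_assoc1)
  moreover have "nonassoc_algebra_axioms K B"
    by unfold_locales (auto dest!: ex simp: eqs A.mult_add_left A.mult_add_right
        A.mult_smult_left A.mult_smult_right)
  ultimately show ?thesis
    by (simp add: nonassoc_algebra_def module_def A.R.cring_axioms)
qed

locale algebra_quotient = nonassoc_algebra K A
  for K :: "('k, 'm) ring_scheme" and A :: "('k, 'a) module" +
  fixes I :: "'a set"
  assumes ideal: "algebra_ideal K A I"
begin

lemmas I = algebra_idealD[OF ideal]

lemma I_carrier: "a \<in> I \<Longrightarrow> a \<in> carrier A"
  using I(1) by auto

sublocale I: abelian_subgroup I A
proof (rule abelian_subgroupI3)
  show "additive_subgroup I A"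
    using ideal unfolding algebra_ideal_def
    by (intro additive_subgroupI submodule.axioms(1)) blast
qed (rule M.abelian_group_axioms)

lemma coset_elem:
  assumes "z \<in> I +>\<^bsub>A\<^esub> x"
  obtains i where "i \<in> I" "z = i \<oplus>\<^bsub>A\<^esub> x"
  using assms by (auto simp: a_r_coset_def' )

lemma coset_eqI:
  assumes "x \<in> carrier A" "i \<in> I"
  shows "I +>\<^bsub>A\<^esub> (i \<oplus>\<^bsub>A\<^esub> x) = I +>\<^bsub>A\<^esub> x"
proof -
  have "i \<oplus>\<^bsub>A\<^esub> x \<in> I +>\<^bsub>A\<^esub> x"
    using assms by (auto simp: a_r_coset_def')
  then show ?thesis
    using I.a_repr_independence'[of "i \<oplus>\<^bsub>A\<^esub> x" x] assms by simp
qed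

lemma coset_eq_if_minus:
  assumes "x \<in> carrier A" "y \<in> carrier A" "x \<ominus>\<^bsub>A\<^esub> y \<in> I"
  shows "I +>\<^bsub>A\<^esub> x = I +>\<^bsub>A\<^esub> y"
proof -
  have "(x \<ominus>\<^bsub>A\<^esub> y) \<oplus>\<^bsub>A\<^esub> y = x"
    using assms by (simp add: a_minus_def M.a_assoc M.l_neg)
  then show ?thesis using coset_eqI[OF assms(2,3)] by simp
qed

lemma coset_self: "x \<in> carrier A \<Longrightarrow> x \<in> I +>\<^bsub>A\<^esub> x"
  using I.a_rcos_self by blast

lemma quotient_carrier: "carrier (quotient_algebra A I) = (\<lambda>x. I +>\<^bsub>A\<^esub> x) ` carrier A"
  by (auto simp: quotient_algebra_def FactRing_def ring.defs module.defs A_RCOSETS_def')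

lemma quotient_carrierE:
  assumes "Z \<in> carrier (quotient_algebra A I)"
  obtains x where "x \<in> carrier A" "Z = I +>\<^bsub>A\<^esub> x"
  using assms by (auto simp: quotient_carrier)

lemma proj_closed [simp, intro]:
  "x \<in> carrier A \<Longrightarrow> I +>\<^bsub>A\<^esub> x \<in> carrier (quotient_algebra A I)"
  by (auto simp: quotient_carrier)

lemma proj_zero: "I +>\<^bsub>A\<^esub> \<zero>\<^bsub>A\<^esub> = \<zero>\<^bsub>quotient_algebra A I\<^esub>"
  using M.a_coset_add_zero[OF I(1)]
  by (simp add: quotient_algebra_def FactRing_def ring.defs module.defs)

lemma proj_ideal: "i \<in> I \<Longrightarrow> I +>\<^bsub>A\<^esub> i = \<zero>\<^bsub>quotient_algebra A I\<^esub>"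
  using coset_eqI[of "\<zero>\<^bsub>A\<^esub>" i] by (simp add: I_carrier flip: proj_zero)

lemma proj_one: "I +>\<^bsub>A\<^esub> \<one>\<^bsub>A\<^esub> = \<one>\<^bsub>quotient_algebra A I\<^esub>"
  by (simp add: quotient_algebra_def FactRing_def ring.defs module.defs)

lemma proj_add:
  "\<lbrakk>x \<in> carrier A; y \<in> carrier A\<rbrakk> \<Longrightarrow>
    I +>\<^bsub>A\<^esub> (x \<oplus>\<^bsub>A\<^esub> y) = (I +>\<^bsub>A\<^esub> x) \<oplus>\<^bsub>quotient_algebra A I\<^esub> (I +>\<^bsub>A\<^esub> y)"
  by (simp add: quotient_algebra_def FactRing_def ring.defs module.defs I.a_rcos_sum)

lemma proj_smult:
  assumes "c \<in> carrier K" "x \<in> carrier A"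
  shows "I +>\<^bsub>A\<^esub> (c \<odot>\<^bsub>A\<^esub> x) = c \<odot>\<^bsub>quotient_algebra A I\<^esub> (I +>\<^bsub>A\<^esub> x)"
proof -
  have "I +>\<^bsub>A\<^esub> (c \<odot>\<^bsub>A\<^esub> z) = I +>\<^bsub>A\<^esub> (c \<odot>\<^bsub>A\<^esub> x)" if "z \<in> I +>\<^bsub>A\<^esub> x" for z
    using that
  proof (rule coset_elem)
    fix i assume "i \<in> I" "z = i \<oplus>\<^bsub>A\<^esub> x"
    then show ?thesis
      using assms by (simp add: I_carrier smult_r_distr coset_eqI I(4))
  qed
  then have "(\<Union>z\<in>I +>\<^bsub>A\<^esub> x. I +>\<^bsub>A\<^esub> (c \<odot>\<^bsub>A\<^esub> z)) = I +>\<^bsub>A\<^esub> (c \<odot>\<^bsub>A\<^esub> x)"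
    using coset_self[OF assms(2)] by blast
  then show ?thesis
    by (simp add: quotient_algebra_def FactRing_def ring.defs module.defs)
qed

lemma proj_mult:
  assumes "x \<in> carrier A" "y \<in> carrier A"
  shows "I +>\<^bsub>A\<^esub> (x \<otimes>\<^bsub>A\<^esub> y) = (I +>\<^bsub>A\<^esub> x) \<otimes>\<^bsub>quotient_algebra A I\<^esub> (I +>\<^bsub>A\<^esub> y)"
proof -
  have "I +>\<^bsub>A\<^esub> (a \<otimes>\<^bsub>A\<^esub> b) = I +>\<^bsub>A\<^esub> (x \<otimes>\<^bsub>A\<^esub> y)"
    if a: "a \<in> I +>\<^bsub>A\<^esub> x" and b: "b \<in> I +>\<^bsub>A\<^esub> y" for a b
  proof -
    obtain i where i: "i \<in> I" "a = i \<oplus>\<^bsub>A\<^esub> x" by (rule coset_elem[OF a])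
    obtain j where j: "j \<in> I" "b = j \<oplus>\<^bsub>A\<^esub> y" by (rule coset_elem[OF b])
    have "a \<otimes>\<^bsub>A\<^esub> b = (i \<otimes>\<^bsub>A\<^esub> (j \<oplus>\<^bsub>A\<^esub> y) \<oplus>\<^bsub>A\<^esub> x \<otimes>\<^bsub>A\<^esub> j) \<oplus>\<^bsub>A\<^esub> x \<otimes>\<^bsub>A\<^esub> y"
      using i j assms by (simp add: I_carrier mult_add_left mult_add_right M.a_ac)
    moreover have "i \<otimes>\<^bsub>A\<^esub> (j \<oplus>\<^bsub>A\<^esub> y) \<oplus>\<^bsub>A\<^esub> x \<otimes>\<^bsub>A\<^esub> j \<in> I"
      using i j assms by (intro I(3,6,7)) (auto simp: I_carrier)
    ultimately show ?thesis using assms by (simp add: coset_eqI)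
  qed
  then have "(\<Union>a\<in>I +>\<^bsub>A\<^esub> x. \<Union>b\<in>I +>\<^bsub>A\<^esub> y. I +>\<^bsub>A\<^esub> (a \<otimes>\<^bsub>A\<^esub> b)) = I +>\<^bsub>A\<^esub> (x \<otimes>\<^bsub>A\<^esub> y)"
    using coset_self assms by blast
  then show ?thesis
    by (simp add: quotient_algebra_def FactRing_def ring.defs module.defs rcoset_mult_def)
qed

lemma nonassoc_algebra_quotient: "nonassoc_algebra K (quotient_algebra A I)"
  by (rule nonassoc_algebra_surj_image[where \<pi> = "\<lambda>x. I +>\<^bsub>A\<^esub> x"])
    (use quotient_carrier proj_zero proj_add proj_smult proj_mult nonassoc_algebra_axioms in auto)

end

text \<open>
  In contrast to \<^const>\<open>algebra_hom\<close>, nothing is asked about \<open>one\<close>, which has no meaning for Lie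
  algebras.
\<close>

definition algebra_map ::
  "('k, 'm) ring_scheme \<Rightarrow> ('k, 'a) module \<Rightarrow> ('k, 'b) module \<Rightarrow> ('a \<Rightarrow> 'b) \<Rightarrow> bool"
  where "algebra_map K A B h \<longleftrightarrow> (\<forall>x\<in>carrier A. h x \<in> carrier B) \<and>
    (\<forall>x\<in>carrier A. \<forall>y\<in>carrier A. h (x \<oplus>\<^bsub>A\<^esub> y) = h x \<oplus>\<^bsub>B\<^esub> h y \<and> h (x \<otimes>\<^bsub>A\<^esub> y) = h x \<otimes>\<^bsub>B\<^esub> h y) \<and>
    (\<forall>c\<in>carrier K. \<forall>x\<in>carrier A. h (c \<odot>\<^bsub>A\<^esub> x) = c \<odot>\<^bsub>B\<^esub> h x)"

lemma algebra_mapI: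
  assumes "\<And>x. x \<in> carrier A \<Longrightarrow> h x \<in> carrier B"
    and "\<And>x y. \<lbrakk>x \<in> carrier A; y \<in> carrier A\<rbrakk> \<Longrightarrow> h (x \<oplus>\<^bsub>A\<^esub> y) = h x \<oplus>\<^bsub>B\<^esub> h y"
    and "\<And>x y. \<lbrakk>x \<in> carrier A; y \<in> carrier A\<rbrakk> \<Longrightarrow> h (x \<otimes>\<^bsub>A\<^esub> y) = h x \<otimes>\<^bsub>B\<^esub> h y"
    and "\<And>c x. \<lbrakk>c \<in> carrier K; x \<in> carrier A\<rbrakk> \<Longrightarrow> h (c \<odot>\<^bsub>A\<^esub> x) = c \<odot>\<^bsub>B\<^esub> h x"
  shows "algebra_map K A B h"
  using assms by (simp add: algebra_map_def)

lemma algebra_map_comp: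
  "\<lbrakk>algebra_map K A B g; algebra_map K B C h\<rbrakk> \<Longrightarrow> algebra_map K A C (\<lambda>x. h (g x))"
  by (simp add: algebra_map_def)

lemma (in algebra_quotient) algebra_map_proj:
  "algebra_map K A (quotient_algebra A I) (\<lambda>x. I +>\<^bsub>A\<^esub> x)"
  by (auto simp: algebra_map_def proj_add proj_smult proj_mult)

locale nonassoc_algebra_map = A: nonassoc_algebra K A + B: nonassoc_algebra K B
  for K :: "('k, 'm) ring_scheme" and A :: "('k, 'a) module" and B :: "('k, 'b) module" +
  fixes h
  assumes map: "algebra_map K A B h"
begin

lemma closed [simp, intro]: "x \<in> carrier A \<Longrightarrow> h x \<in> carrier B"
  and add: "\<lbrakk>x \<in> carrier A; y \<in> carrier A\<rbrakk> \<Longrightarrow> h (x \<oplus>\<^bsub>A\<^esub> y) = h x \<oplus>\<^bsub>B\<^esub> h y"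
  and mult: "\<lbrakk>x \<in> carrier A; y \<in> carrier A\<rbrakk> \<Longrightarrow> h (x \<otimes>\<^bsub>A\<^esub> y) = h x \<otimes>\<^bsub>B\<^esub> h y"
  and smult: "\<lbrakk>c \<in> carrier K; x \<in> carrier A\<rbrakk> \<Longrightarrow> h (c \<odot>\<^bsub>A\<^esub> x) = c \<odot>\<^bsub>B\<^esub> h x"
  using map by (auto simp: algebra_map_def)

lemma zero [simp]: "h \<zero>\<^bsub>A\<^esub> = \<zero>\<^bsub>B\<^esub>"
  using smult[of "\<zero>\<^bsub>K\<^esub>" "\<zero>\<^bsub>A\<^esub>"] by simp

lemma uminus: "x \<in> carrier A \<Longrightarrow> h (\<ominus>\<^bsub>A\<^esub> x) = \<ominus>\<^bsub>B\<^esub> h x"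
  using smult[of "\<ominus>\<^bsub>K\<^esub> \<one>\<^bsub>K\<^esub>" x] by (simp add: A.smult_neg_one B.smult_neg_one)

lemma minus: "\<lbrakk>x \<in> carrier A; y \<in> carrier A\<rbrakk> \<Longrightarrow> h (x \<ominus>\<^bsub>A\<^esub> y) = h x \<ominus>\<^bsub>B\<^esub> h y"
  by (simp add: a_minus_def add uminus)

lemma finsum:
  assumes "finite F" "g \<in> F \<rightarrow> carrier A"
  shows "h (\<Oplus>\<^bsub>A\<^esub>i\<in>F. g i) = (\<Oplus>\<^bsub>B\<^esub>i\<in>F. h (g i))"
  using assms by (induction F) (auto simp: add Pi_iff)

lemma vimage_submodule:
  assumes "submodule H K B"
  shows "submodule {x \<in> carrier A. h x \<in> H} K A"
proof (rule A.submodule_closedI)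
  show "\<zero>\<^bsub>A\<^esub> \<in> {x \<in> carrier A. h x \<in> H}"
    using subgroup.one_closed[OF submodule.axioms(1)[OF assms]] by simp
qed (use B.submoduleE[OF assms] in \<open>auto simp: add smult\<close>)

lemma kernel_ideal: "algebra_ideal K A {x \<in> carrier A. h x = \<zero>\<^bsub>B\<^esub>}"
proof -
  have "submodule {x \<in> carrier A. h x = \<zero>\<^bsub>B\<^esub>} K A"
    by (rule A.submodule_closedI) (auto simp: add smult)
  then show ?thesis
    by (auto simp: algebra_ideal_def mult)
qed

end

text \<open>
  The induced map on the quotient is written with \<^const>\<open>the_elem\<close>, because this is the form in
  which \<^const>\<open>enveloping_lift\<close> is given.
\<close>

locale quotient_lift = nonassoc_algebra_map K A B h + algebra_quotient K A I
  for K :: "('k, 'm) ring_scheme" and A :: "('k, 'a) module" and B :: "('k, 'b) module"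
    and h and I +
  assumes kills: "x \<in> I \<Longrightarrow> h x = \<zero>\<^bsub>B\<^esub>"
begin

lemma lift_coset:
  assumes "x \<in> carrier A"
  shows "the_elem (h ` (I +>\<^bsub>A\<^esub> x)) = h x"
proof -
  have "h z = h x" if "z \<in> I +>\<^bsub>A\<^esub> x" for z
    using that
  proof (rule coset_elem)
    fix i assume "i \<in> I" "z = i \<oplus>\<^bsub>A\<^esub> x"
    then show ?thesis using assms by (simp add: I_carrier add kills)
  qed
  then have "h ` (I +>\<^bsub>A\<^esub> x) = {h x}"
    using coset_self[OF assms] by blast
  then show ?thesis by simp
qed

lemma algebra_map_lift: "algebra_map K (quotient_algebra A I) B (\<lambda>Z. the_elem (h ` Z))"
  by (rule algebra_mapI; elim quotient_carrierE)
    (simp_all add: lift_coset add smult mult flip: proj_add proj_smult proj_mult)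

end

section \<open>Associative algebras and their commutator brackets\<close>

locale assoc_algebra = nonassoc_algebra K A
  for K :: "('k, 'm) ring_scheme" and A :: "('k, 'a) module" +
  assumes unit_closed: "\<one>\<^bsub>A\<^esub> \<in> carrier A"
    and mult_assoc: "\<lbrakk>x \<in> carrier A; y \<in> carrier A; z \<in> carrier A\<rbrakk> \<Longrightarrow>
      (x \<otimes>\<^bsub>A\<^esub> y) \<otimes>\<^bsub>A\<^esub> z = x \<otimes>\<^bsub>A\<^esub> (y \<otimes>\<^bsub>A\<^esub> z)"
    and unit_left: "x \<in> carrier A \<Longrightarrow> \<one>\<^bsub>A\<^esub> \<otimes>\<^bsub>A\<^esub> x = x"
    and unit_right: "x \<in> carrier A \<Longrightarrow> x \<otimes>\<^bsub>A\<^esub> \<one>\<^bsub>A\<^esub> = x"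

sublocale assoc_algebra \<subseteq> A: ring A
  by (intro ringI monoidI M.abelian_group_axioms)
    (auto simp: unit_closed mult_assoc unit_left unit_right mult_add_left mult_add_right)

definition commutator_algebra :: "('k, 'a) module \<Rightarrow> ('k, 'a) module"
  where "commutator_algebra A = A\<lparr>monoid.mult := \<lambda>x y. x \<otimes>\<^bsub>A\<^esub> y \<ominus>\<^bsub>A\<^esub> y \<otimes>\<^bsub>A\<^esub> x\<rparr>"

lemma commutator_algebra_simps [simp]:
  "carrier (commutator_algebra A) = carrier A"
  "zero (commutator_algebra A) = zero A"
  "add (commutator_algebra A) = add A"
  "smult (commutator_algebra A) = smult A"
  "x \<otimes>\<^bsub>commutator_algebra A\<^esub> y = x \<otimes>\<^bsub>A\<^esub> y \<ominus>\<^bsub>A\<^esub> y \<otimes>\<^bsub>A\<^esub> x"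
  by (simp_all add: commutator_algebra_def)

lemma a_inv_commutator_algebra [simp]: "a_inv (commutator_algebra A) = a_inv A"
  by (simp add: a_inv_def m_inv_def fun_eq_iff)

lemma module_congI:
  assumes "module K A" "carrier B = carrier A" "zero B = zero A" "add B = add A" "smult B = smult A"
  shows "module K B"
proof -
  interpret A: module K A by fact
  have "abelian_group B"
    by (rule abelian_groupI) (use assms A.M.a_assoc A.M.a_comm in \<open>auto intro: A.M.l_neg\<close>)
  then show ?thesis
    by (rule moduleI[OF A.R.cring_axioms])
      (use assms in \<open>auto simp: A.smult_l_distr A.smult_r_distr A.smult_assoc1\<close>)
qed

context assoc_algebra
begin

lemma nonassoc_algebra_commutator: "nonassoc_algebra K (commutator_algebra A)"
proof -
  have "module K (commutator_algebra A)"
    by (rule module_congI[OF module_axioms]) auto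
  moreover have "nonassoc_algebra_axioms K (commutator_algebra A)"
  proof
    fix x y z assume c: "x \<in> carrier (commutator_algebra A)"
      "y \<in> carrier (commutator_algebra A)" "z \<in> carrier (commutator_algebra A)"
    show "(x \<oplus>\<^bsub>commutator_algebra A\<^esub> y) \<otimes>\<^bsub>commutator_algebra A\<^esub> z =
        x \<otimes>\<^bsub>commutator_algebra A\<^esub> z \<oplus>\<^bsub>commutator_algebra A\<^esub> y \<otimes>\<^bsub>commutator_algebra A\<^esub> z"
      and "z \<otimes>\<^bsub>commutator_algebra A\<^esub> (x \<oplus>\<^bsub>commutator_algebra A\<^esub> y) =
        z \<otimes>\<^bsub>commutator_algebra A\<^esub> x \<oplus>\<^bsub>commutator_algebra A\<^esub> z \<otimes>\<^bsub>commutator_algebra A\<^esub> y"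
      using c by (simp_all, (simp only: a_minus_def, algebra)+)
  qed (auto simp: mult_smult_left mult_smult_right smult_r_distr smult_r_minus a_minus_def)
  ultimately show ?thesis by (simp add: nonassoc_algebra_def)
qed

lemma commutator_Jacobi:
  assumes "x \<in> carrier A" "y \<in> carrier A" "z \<in> carrier A"
  shows "x \<otimes>\<^bsub>commutator_algebra A\<^esub> (y \<otimes>\<^bsub>commutator_algebra A\<^esub> z) \<oplus>\<^bsub>A\<^esub>
    y \<otimes>\<^bsub>commutator_algebra A\<^esub> (z \<otimes>\<^bsub>commutator_algebra A\<^esub> x) \<oplus>\<^bsub>A\<^esub>
    z \<otimes>\<^bsub>commutator_algebra A\<^esub> (x \<otimes>\<^bsub>commutator_algebra A\<^esub> y) = \<zero>\<^bsub>A\<^esub>"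
  using assms by (simp, simp only: a_minus_def, algebra)

lemma algebra_map_commutator:
  assumes "assoc_algebra K B" "algebra_map K A B h"
  shows "algebra_map K (commutator_algebra A) (commutator_algebra B) h"
proof -
  interpret B: assoc_algebra K B by fact
  interpret nonassoc_algebra_map K A B h
    by unfold_locales fact
  show ?thesis
    by (auto simp: algebra_map_def add smult mult minus)
qed

end

lemma assoc_algebra_quotient:
  assumes "assoc_algebra K A" "algebra_ideal K A I"
  shows "assoc_algebra K (quotient_algebra A I)"
proof -
  interpret assoc_algebra K A by fact
  interpret algebra_quotient K A I by unfold_locales fact
  show ?thesis
    by (intro assoc_algebra.intro nonassoc_algebra_quotient, unfold_locales)
      (auto elim!: quotient_carrierE simp: A.m_assoc simp flip: proj_one proj_mult)
qed

text \<open>A ring ideal is closed under scalars because \<open>c \<odot> a = (c \<odot> \<one>) \<otimes> a\<close>.\<close>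

lemma (in assoc_algebra) ideal_imp_algebra_ideal:
  assumes "Ideal.ideal I A"
  shows "algebra_ideal K A I"
proof -
  interpret I: Ideal.ideal I A by fact
  have "c \<odot>\<^bsub>A\<^esub> a \<in> I" if "c \<in> carrier K" "a \<in> I" for c a
  proof -
    have "c \<odot>\<^bsub>A\<^esub> a = (c \<odot>\<^bsub>A\<^esub> \<one>\<^bsub>A\<^esub>) \<otimes>\<^bsub>A\<^esub> a"
      using that by (simp add: mult_smult_left)
    then show ?thesis using that by (simp add: I.I_l_closed)
  qed
  then show ?thesis
    unfolding algebra_ideal_def
    by (intro conjI submodule_closedI) (auto intro: I.I_l_closed I.I_r_closed)
qed

lemma (in assoc_algebra) algebra_ideal_imp_ideal:
  assumes "algebra_ideal K A I"
  shows "Ideal.ideal I A"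
  using assms algebra_idealD[OF assms] unfolding algebra_ideal_def
  by (intro idealI A.ring_axioms) (auto intro: submodule.axioms(1))

section \<open>Free modules on words\<close>

text \<open>
  The free non-associative algebra and the free associative algebra have the same underlying module
  up to the choice of the words, and only their products differ.  Everything that depends on the
  module structure alone is done here for both.
\<close>

locale finsupp_module = cring K
  for K :: "('k, 'm) ring_scheme" and W :: "'w set" and A :: "('k, 'w \<Rightarrow> 'k) module" +
  assumes carrier_A: "carrier A = {f. range f \<subseteq> carrier K \<and> finite {w. f w \<noteq> \<zero>\<^bsub>K\<^esub>} \<and>
      (\<forall>w. f w \<noteq> \<zero>\<^bsub>K\<^esub> \<longrightarrow> w \<in> W)}"
    and zero_A: "zero A = (\<lambda>w. \<zero>\<^bsub>K\<^esub>)"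
    and add_A: "add A = (\<lambda>f g w. f w \<oplus>\<^bsub>K\<^esub> g w)"
    and smult_A: "smult A = (\<lambda>c f w. c \<otimes>\<^bsub>K\<^esub> f w)"
begin

lemma carrierD:
  assumes "f \<in> carrier A"
  shows "f w \<in> carrier K" "finite {w. f w \<noteq> \<zero>\<^bsub>K\<^esub>}" "f w \<noteq> \<zero>\<^bsub>K\<^esub> \<Longrightarrow> w \<in> W"
  using assms by (auto simp: carrier_A)

lemma carrierI:
  assumes "\<And>w. f w \<in> carrier K" "finite V" "\<And>w. f w \<noteq> \<zero>\<^bsub>K\<^esub> \<Longrightarrow> w \<in> V \<and> w \<in> W"
  shows "f \<in> carrier A"
  using assms finite_subset[of "{w. f w \<noteq> \<zero>\<^bsub>K\<^esub>}" V] by (auto simp: carrier_A)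

lemma add_closed_A: "\<lbrakk>f \<in> carrier A; g \<in> carrier A\<rbrakk> \<Longrightarrow> f \<oplus>\<^bsub>A\<^esub> g \<in> carrier A"
  by (rule carrierI[of _ "{w. f w \<noteq> \<zero>\<^bsub>K\<^esub>} \<union> {w. g w \<noteq> \<zero>\<^bsub>K\<^esub>}"])
    (auto simp: add_A carrierD, (metis carrierD(3) l_zero zero_closed)+)

lemma smult_closed_A: "\<lbrakk>c \<in> carrier K; f \<in> carrier A\<rbrakk> \<Longrightarrow> c \<odot>\<^bsub>A\<^esub> f \<in> carrier A"
  by (rule carrierI[of _ "{w. f w \<noteq> \<zero>\<^bsub>K\<^esub>}"]) (auto simp: smult_A carrierD, (metis carrierD(3) r_null)+)

lemma module_A: "module K A"
proof (rule moduleI[OF cring_axioms])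
  show "abelian_group A"
  proof (rule abelian_groupI)
    fix f assume f: "f \<in> carrier A"
    then show "\<exists>g\<in>carrier A. g \<oplus>\<^bsub>A\<^esub> f = \<zero>\<^bsub>A\<^esub>"
      by (intro bexI[of _ "(\<ominus>\<^bsub>K\<^esub> \<one>\<^bsub>K\<^esub>) \<odot>\<^bsub>A\<^esub> f"] smult_closed_A)
        (auto simp: add_A smult_A zero_A carrierD l_minus l_neg)
  next
    show "\<zero>\<^bsub>A\<^esub> \<in> carrier A" by (auto simp: carrier_A zero_A)
  qed (auto simp: add_closed_A, auto simp: add_A zero_A carrierD a_ac)
qed (auto simp: smult_closed_A, auto simp: add_A smult_A carrierD l_distr r_distr m_assoc)

lemma basis_closed [simp]: "w \<in> W \<Longrightarrow> basis_elem K w \<in> carrier A"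
  by (rule carrierI[of _ "{w}"]) (auto simp: basis_elem_def split: if_splits)

text \<open>
  This is how identities between multilinear expressions are reduced to basis elements.
\<close>

lemma finsupp_induct [consumes 1, case_names zero add smult basis]:
  assumes f: "f \<in> carrier A"
    and zero: "R \<zero>\<^bsub>A\<^esub>"
    and add: "\<And>f g. \<lbrakk>f \<in> carrier A; g \<in> carrier A; R f; R g\<rbrakk> \<Longrightarrow> R (f \<oplus>\<^bsub>A\<^esub> g)"
    and smult: "\<And>c f. \<lbrakk>c \<in> carrier K; f \<in> carrier A; R f\<rbrakk> \<Longrightarrow> R (c \<odot>\<^bsub>A\<^esub> f)"
    and basis: "\<And>w. w \<in> W \<Longrightarrow> R (basis_elem K w)"
  shows "R f"
proof -
  have "R f" if "finite V" "f \<in> carrier A" "{w. f w \<noteq> \<zero>\<^bsub>K\<^esub>} \<subseteq> V" for f V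
    using that
  proof (induction V arbitrary: f)
    case empty
    then have "f = \<zero>\<^bsub>A\<^esub>" by (auto simp: zero_A)
    then show ?case using zero by simp
  next
    case (insert v V)
    show ?case
    proof (cases "f v = \<zero>\<^bsub>K\<^esub>")
      case True
      then show ?thesis using insert by blast
    next
      case False
      let ?g = "f(v := \<zero>\<^bsub>K\<^esub>)"
      have g: "?g \<in> carrier A"
        by (rule carrierI[of _ "{w. f w \<noteq> \<zero>\<^bsub>K\<^esub>}"])
          (use insert.prems carrierD in \<open>auto split: if_splits\<close>)
      have v: "v \<in> W" using insert.prems False carrierD by blast
      have "R ?g" by (rule insert.IH[OF g]) (use insert.prems in auto)
      moreover have "f v \<odot>\<^bsub>A\<^esub> basis_elem K v \<oplus>\<^bsub>A\<^esub> ?g = f"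
        using insert.prems by (auto simp: add_A smult_A basis_elem_def fun_eq_iff carrierD)
      ultimately show ?thesis
        using add[of "f v \<odot>\<^bsub>A\<^esub> basis_elem K v" ?g] smult[of "f v" "basis_elem K v"]
          basis[OF v] g v insert.prems smult_closed_A carrierD by (metis basis_closed)
    qed
  qed
  then show ?thesis using f carrierD(2)[OF f] by blast
qed

end

text \<open>The linear map that sends the basis element of each word \<open>w\<close> to \<open>e w\<close>.\<close>

definition linear_extension ::
  "('k, 'm) ring_scheme \<Rightarrow> ('k, 'b) module \<Rightarrow> ('w \<Rightarrow> 'b) \<Rightarrow> ('w \<Rightarrow> 'k) \<Rightarrow> 'b"
  where "linear_extension K B e f = (\<Oplus>\<^bsub>B\<^esub>w\<in>{w. f w \<noteq> \<zero>\<^bsub>K\<^esub>}. f w \<odot>\<^bsub>B\<^esub> e w)"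

locale finsupp_extension = finsupp_module K W A + B: module K B
  for K :: "('k, 'm) ring_scheme" and W :: "'w set" and A :: "('k, 'w \<Rightarrow> 'k) module"
    and B :: "('k, 'b) module" +
  fixes e :: "'w \<Rightarrow> 'b"
  assumes e_closed: "w \<in> W \<Longrightarrow> e w \<in> carrier B"
begin

text \<open>
  The supports of \<open>f\<close>, \<open>g\<close> and \<open>f + g\<close> differ, so additivity needs sums over a common finite set.
\<close>

lemma linear_extension_eq:
  assumes "f \<in> carrier A" "finite V" "{w. f w \<noteq> \<zero>\<^bsub>K\<^esub>} \<subseteq> V" "V \<subseteq> W"
  shows "linear_extension K B e f = (\<Oplus>\<^bsub>B\<^esub>w\<in>V. f w \<odot>\<^bsub>B\<^esub> e w)"
  unfolding linear_extension_def
  by (rule B.M.add.finprod_mono_neutral_cong_left)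
    (use assms e_closed carrierD in \<open>auto simp: subset_iff\<close>)

lemma support_subset: "f \<in> carrier A \<Longrightarrow> {w. f w \<noteq> \<zero>\<^bsub>K\<^esub>} \<subseteq> W"
  using carrierD(3) by blast

lemma linear_extension_closed: "f \<in> carrier A \<Longrightarrow> linear_extension K B e f \<in> carrier B"
  unfolding linear_extension_def
  by (intro B.M.finsum_closed) (auto simp: carrierD e_closed)

lemma linear_extension_add:
  assumes "f \<in> carrier A" "g \<in> carrier A"
  shows "linear_extension K B e (f \<oplus>\<^bsub>A\<^esub> g) =
    linear_extension K B e f \<oplus>\<^bsub>B\<^esub> linear_extension K B e g"
proof -
  let ?V = "{w. f w \<noteq> \<zero>\<^bsub>K\<^esub>} \<union> {w. g w \<noteq> \<zero>\<^bsub>K\<^esub>}"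
  have V: "finite ?V" "?V \<subseteq> W"
    using assms carrierD support_subset by auto
  have "{w. (f \<oplus>\<^bsub>A\<^esub> g) w \<noteq> \<zero>\<^bsub>K\<^esub>} \<subseteq> ?V" by (auto simp: add_A)
  then have "linear_extension K B e (f \<oplus>\<^bsub>A\<^esub> g) = (\<Oplus>\<^bsub>B\<^esub>w\<in>?V. (f \<oplus>\<^bsub>A\<^esub> g) w \<odot>\<^bsub>B\<^esub> e w)"
    using V assms by (intro linear_extension_eq add_closed_A)
  also have "\<dots> = (\<Oplus>\<^bsub>B\<^esub>w\<in>?V. f w \<odot>\<^bsub>B\<^esub> e w \<oplus>\<^bsub>B\<^esub> g w \<odot>\<^bsub>B\<^esub> e w)"
    using assms V carrierD e_closed
    by (intro B.M.finsum_cong' refl) (auto simp: add_A B.smult_l_distr)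
  also have "\<dots> = (\<Oplus>\<^bsub>B\<^esub>w\<in>?V. f w \<odot>\<^bsub>B\<^esub> e w) \<oplus>\<^bsub>B\<^esub> (\<Oplus>\<^bsub>B\<^esub>w\<in>?V. g w \<odot>\<^bsub>B\<^esub> e w)"
    using assms V carrierD e_closed by (intro B.M.finsum_addf) auto
  finally show ?thesis
    using linear_extension_eq[of f ?V] linear_extension_eq[of g ?V] V assms by simp
qed

lemma linear_extension_smult:
  assumes "c \<in> carrier K" "f \<in> carrier A"
  shows "linear_extension K B e (c \<odot>\<^bsub>A\<^esub> f) = c \<odot>\<^bsub>B\<^esub> linear_extension K B e f"
proof -
  let ?V = "{w. f w \<noteq> \<zero>\<^bsub>K\<^esub>}"
  have V: "finite ?V" "?V \<subseteq> W" using assms carrierD by auto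
  have "{w. (c \<odot>\<^bsub>A\<^esub> f) w \<noteq> \<zero>\<^bsub>K\<^esub>} \<subseteq> ?V" using assms by (auto simp: smult_A)
  then have "linear_extension K B e (c \<odot>\<^bsub>A\<^esub> f) = (\<Oplus>\<^bsub>B\<^esub>w\<in>?V. (c \<odot>\<^bsub>A\<^esub> f) w \<odot>\<^bsub>B\<^esub> e w)"
    using V assms by (intro linear_extension_eq smult_closed_A)
  also have "\<dots> = (\<Oplus>\<^bsub>B\<^esub>w\<in>?V. c \<odot>\<^bsub>B\<^esub> (f w \<odot>\<^bsub>B\<^esub> e w))"
    using assms V carrierD e_closed
    by (intro B.M.finsum_cong' refl) (auto simp: smult_A B.smult_assoc1)
  also have "\<dots> = c \<odot>\<^bsub>B\<^esub> linear_extension K B e f"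
    unfolding linear_extension_def using assms V carrierD e_closed
    by (intro B.finsum_smult_ldistr[symmetric]) auto
  finally show ?thesis .
qed

lemma linear_extension_basis:
  assumes "w \<in> W"
  shows "linear_extension K B e (basis_elem K w) = e w"
proof -
  have "linear_extension K B e (basis_elem K w) = (\<Oplus>\<^bsub>B\<^esub>v\<in>{w}. basis_elem K w v \<odot>\<^bsub>B\<^esub> e v)"
    by (intro linear_extension_eq basis_closed) (use assms in \<open>auto simp: basis_elem_def\<close>)
  also have "\<dots> = e w"
    using assms by (simp add: e_closed basis_elem_def)
  finally show ?thesis .
qed

lemma linear_extension_mult:
  assumes A: "nonassoc_algebra K A" and B: "nonassoc_algebra K B"
    and basis: "\<And>u v. \<lbrakk>u \<in> W; v \<in> W\<rbrakk> \<Longrightarrow> linear_extension K B e (basis_elem K u \<otimes>\<^bsub>A\<^esub> basis_elem K v) = e u \<otimes>\<^bsub>B\<^esub> e v"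
    and f: "f \<in> carrier A" and g: "g \<in> carrier A"
  shows "linear_extension K B e (f \<otimes>\<^bsub>A\<^esub> g) = linear_extension K B e f \<otimes>\<^bsub>B\<^esub> linear_extension K B e g"
proof -
  interpret A: nonassoc_algebra K A by fact
  interpret NB: nonassoc_algebra K B by fact
  note bilin = A.mult_add_left A.mult_add_right A.mult_smult_left A.mult_smult_right
    NB.mult_add_left NB.mult_add_right NB.mult_smult_left NB.mult_smult_right
    linear_extension_add linear_extension_smult linear_extension_closed
  have zero: "linear_extension K B e \<zero>\<^bsub>A\<^esub> = \<zero>\<^bsub>B\<^esub>"
    using linear_extension_smult[of "\<zero>\<^bsub>K\<^esub>" "\<zero>\<^bsub>A\<^esub>"] linear_extension_closed by simp
  from f show ?thesis
  proof (induction f rule: finsupp_induct)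
    case (basis u)
    from g show ?case
    proof (induction g rule: finsupp_induct)
      case (basis v)
      then show ?case using assms \<open>u \<in> W\<close> by (simp add: linear_extension_basis)
    qed (use \<open>u \<in> W\<close> in \<open>auto simp: bilin zero\<close>)
  qed (use g in \<open>auto simp: bilin zero\<close>)
qed

end

section \<open>Free non-associative and free associative algebras\<close>

lemma finsupp_module_free_nonassoc:
  assumes "cring K"
  shows "finsupp_module K {t. set_magma_word t \<subseteq> S} (free_nonassoc K S)"
  using assms by (auto simp: finsupp_module_def finsupp_module_axioms_def free_nonassoc_def)

lemma nonassoc_algebra_free_nonassoc:
  assumes "cring K"
  shows "nonassoc_algebra K (free_nonassoc K S)" (is "nonassoc_algebra K ?F")
proof -
  interpret finsupp_module K "{t. set_magma_word t \<subseteq> S}" ?F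
    by (rule finsupp_module_free_nonassoc) fact
  have mult: "(f \<otimes>\<^bsub>?F\<^esub> g) t = (case t of Leaf x \<Rightarrow> \<zero>\<^bsub>K\<^esub> | Node s u \<Rightarrow> f s \<otimes>\<^bsub>K\<^esub> g u)" for f g t
    by (simp add: free_nonassoc_def)
  have "f \<otimes>\<^bsub>?F\<^esub> g \<in> carrier ?F" if f: "f \<in> carrier ?F" and g: "g \<in> carrier ?F" for f g
  proof (rule carrierI)
    let ?V = "(\<lambda>(s, u). Node s u) ` ({s. f s \<noteq> \<zero>\<^bsub>K\<^esub>} \<times> {u. g u \<noteq> \<zero>\<^bsub>K\<^esub>})"
    show "finite ?V" using f g carrierD by auto
    fix t show "(f \<otimes>\<^bsub>?F\<^esub> g) t \<in> carrier K"
      using f g by (auto simp: mult carrierD split: magma_word.split)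
    assume "(f \<otimes>\<^bsub>?F\<^esub> g) t \<noteq> \<zero>\<^bsub>K\<^esub>"
    then obtain s u where t: "t = Node s u" and "f s \<otimes>\<^bsub>K\<^esub> g u \<noteq> \<zero>\<^bsub>K\<^esub>"
      by (auto simp: mult split: magma_word.splits)
    then have "f s \<noteq> \<zero>\<^bsub>K\<^esub>" "g u \<noteq> \<zero>\<^bsub>K\<^esub>"
      using f g carrierD(1) by (metis l_null, metis r_null)
    then show "t \<in> ?V \<and> t \<in> {t. set_magma_word t \<subseteq> S}"
      using carrierD(3)[OF f, of s] carrierD(3)[OF g, of u] t by auto
  qed
  then have "nonassoc_algebra_axioms K ?F"
    by unfold_locales
      (auto simp: mult add_A smult_A carrierD l_distr r_distr m_ac fun_eq_iff split: magma_word.split)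
  then show ?thesis
    using module_A by (simp add: nonassoc_algebra_def)
qed

primrec magma_eval :: "('k, 'b) module \<Rightarrow> ('x \<Rightarrow> 'b) \<Rightarrow> 'x magma_word \<Rightarrow> 'b"
  where "magma_eval B e (Leaf x) = e x"
  | "magma_eval B e (Node s t) = magma_eval B e s \<otimes>\<^bsub>B\<^esub> magma_eval B e t"

lemma (in nonassoc_algebra) magma_eval_closed:
  assumes "\<And>x. x \<in> set_magma_word t \<Longrightarrow> e x \<in> carrier A"
  shows "magma_eval A e t \<in> carrier A"
  using assms by (induction t) auto

lemma free_nonassoc_lift:
  assumes B: "nonassoc_algebra K B" and e: "\<And>x. x \<in> S \<Longrightarrow> e x \<in> carrier B"
  shows "algebra_map K (free_nonassoc K S) B (linear_extension K B (magma_eval B e))"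
    and "\<And>x. x \<in> S \<Longrightarrow> linear_extension K B (magma_eval B e) (basis_elem K (Leaf x)) = e x"
proof -
  interpret B: nonassoc_algebra K B by fact
  interpret F: nonassoc_algebra K "free_nonassoc K S"
    by (rule nonassoc_algebra_free_nonassoc) (rule B.R.cring_axioms)
  interpret finsupp_extension K "{t. set_magma_word t \<subseteq> S}" "free_nonassoc K S" B "magma_eval B e"
    by (intro finsupp_extension.intro finsupp_module_free_nonassoc B.R.cring_axioms B.module_axioms)
      (use e in \<open>auto simp: finsupp_extension_axioms_def intro!: B.magma_eval_closed\<close>)
  have basis: "basis_elem K u \<otimes>\<^bsub>free_nonassoc K S\<^esub> basis_elem K v = basis_elem K (Node u v)" for u v
    by (auto simp: free_nonassoc_def basis_elem_def fun_eq_iff split: magma_word.split)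
  have "linear_extension K B (magma_eval B e) (f \<otimes>\<^bsub>free_nonassoc K S\<^esub> g) =
      linear_extension K B (magma_eval B e) f \<otimes>\<^bsub>B\<^esub> linear_extension K B (magma_eval B e) g"
    if "f \<in> carrier (free_nonassoc K S)" "g \<in> carrier (free_nonassoc K S)" for f g
    using that
    by (intro linear_extension_mult F.nonassoc_algebra_axioms B) (auto simp: basis linear_extension_basis)
  then show "algebra_map K (free_nonassoc K S) B (linear_extension K B (magma_eval B e))"
    by (intro algebra_mapI linear_extension_closed linear_extension_add linear_extension_smult)
  show "linear_extension K B (magma_eval B e) (basis_elem K (Leaf x)) = e x" if "x \<in> S" for x
    using that by (simp add: linear_extension_basis)
qed

lemma finsupp_module_free_algebra:
  assumes "cring K"
  shows "finsupp_module K (lists S) (free_algebra K S)"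
  using assms
  by (auto simp: finsupp_module_def finsupp_module_axioms_def free_algebra_def in_lists_conv_set subset_iff)

lemma (in cring) basis_mult_free_algebra:
  "basis_elem R u \<otimes>\<^bsub>free_algebra R S\<^esub> basis_elem R v = basis_elem R (u @ v)"
proof
  fix w
  let ?h = "\<lambda>i. basis_elem R u (take i w) \<otimes> basis_elem R v (drop i w)"
  have "(basis_elem R u \<otimes>\<^bsub>free_algebra R S\<^esub> basis_elem R v) w = (\<Oplus>i\<in>{..length w}. ?h i)"
    by (simp add: free_algebra_def)
  also have "\<dots> = basis_elem R (u @ v) w"
  proof (cases "w = u @ v")
    case True
    have ne: "take i w \<noteq> u" if "i \<in> {..length w} - {length u}" for i
      using that by auto
    have "(\<Oplus>i\<in>{length u}. ?h i) = (\<Oplus>i\<in>{..length w}. ?h i)"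
      by (rule add.finprod_mono_neutral_cong_left)
        (use True ne in \<open>auto simp: basis_elem_def simp del: take_append\<close>)
    then show ?thesis using True by (simp add: basis_elem_def)
  next
    case False
    then have "?h i = \<zero>" for i
      by (auto simp: basis_elem_def)
    then show ?thesis using False by (simp add: basis_elem_def)
  qed
  finally show "(basis_elem R u \<otimes>\<^bsub>free_algebra R S\<^esub> basis_elem R v) w = basis_elem R (u @ v) w" .
qed

lemma nonassoc_algebra_free_algebra:
  assumes "cring K"
  shows "nonassoc_algebra K (free_algebra K S)" (is "nonassoc_algebra K ?T")
proof -
  interpret finsupp_module K "lists S" ?T
    by (rule finsupp_module_free_algebra) fact
  have mult: "(f \<otimes>\<^bsub>?T\<^esub> g) w = (\<Oplus>\<^bsub>K\<^esub>i\<in>{..length w}. f (take i w) \<otimes>\<^bsub>K\<^esub> g (drop i w))" for f g w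
    by (simp add: free_algebra_def)
  have "f \<otimes>\<^bsub>?T\<^esub> g \<in> carrier ?T" if f: "f \<in> carrier ?T" and g: "g \<in> carrier ?T" for f g
  proof (rule carrierI)
    let ?V = "(\<lambda>(u, v). u @ v) ` ({u. f u \<noteq> \<zero>\<^bsub>K\<^esub>} \<times> {v. g v \<noteq> \<zero>\<^bsub>K\<^esub>})"
    show "finite ?V" using f g carrierD by auto
    fix w show "(f \<otimes>\<^bsub>?T\<^esub> g) w \<in> carrier K"
      using f g by (auto simp: mult carrierD intro!: finsum_closed)
    assume "(f \<otimes>\<^bsub>?T\<^esub> g) w \<noteq> \<zero>\<^bsub>K\<^esub>"
    then obtain i where "f (take i w) \<otimes>\<^bsub>K\<^esub> g (drop i w) \<noteq> \<zero>\<^bsub>K\<^esub>"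
      unfolding mult by (metis (mono_tags, lifting) add.finprod_one_eqI)
    then have nz: "f (take i w) \<noteq> \<zero>\<^bsub>K\<^esub>" "g (drop i w) \<noteq> \<zero>\<^bsub>K\<^esub>"
      using f g carrierD(1) by (metis l_null, metis r_null)
    have "take i w @ drop i w \<in> lists S"
      using carrierD(3)[OF f nz(1)] carrierD(3)[OF g nz(2)] by (simp only: append_in_lists_conv)
    moreover have "w \<in> ?V"
      using nz by (auto intro!: image_eqI[of _ _ "(take i w, drop i w)"])
    ultimately show "w \<in> ?V \<and> w \<in> lists S" by simp
  qed
  then have "nonassoc_algebra_axioms K ?T"
  proof unfold_locales
    fix f g h assume c: "f \<in> carrier ?T" "g \<in> carrier ?T" "h \<in> carrier ?T"
    show "(f \<oplus>\<^bsub>?T\<^esub> g) \<otimes>\<^bsub>?T\<^esub> h = f \<otimes>\<^bsub>?T\<^esub> h \<oplus>\<^bsub>?T\<^esub> g \<otimes>\<^bsub>?T\<^esub> h"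
      and "h \<otimes>\<^bsub>?T\<^esub> (f \<oplus>\<^bsub>?T\<^esub> g) = h \<otimes>\<^bsub>?T\<^esub> f \<oplus>\<^bsub>?T\<^esub> h \<otimes>\<^bsub>?T\<^esub> g"
      using c by (auto simp: fun_eq_iff mult add_A carrierD l_distr r_distr Pi_iff simp flip: finsum_addf)
  next
    fix c f g assume c: "c \<in> carrier K" "f \<in> carrier ?T" "g \<in> carrier ?T"
    show "(c \<odot>\<^bsub>?T\<^esub> f) \<otimes>\<^bsub>?T\<^esub> g = c \<odot>\<^bsub>?T\<^esub> (f \<otimes>\<^bsub>?T\<^esub> g)"
      and "f \<otimes>\<^bsub>?T\<^esub> (c \<odot>\<^bsub>?T\<^esub> g) = c \<odot>\<^bsub>?T\<^esub> (f \<otimes>\<^bsub>?T\<^esub> g)"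
      using c by (auto simp: fun_eq_iff mult smult_A carrierD finsum_rdistr m_ac Pi_iff)
  qed
  then show ?thesis
    using module_A by (simp add: nonassoc_algebra_def)
qed

text \<open>
  By trilinearity it is enough to check associativity on words, where the product is concatenation.
\<close>

lemma assoc_algebra_free_algebra:
  assumes "cring K"
  shows "assoc_algebra K (free_algebra K S)" (is "assoc_algebra K ?T")
proof -
  interpret finsupp_module K "lists S" ?T
    by (rule finsupp_module_free_algebra) fact
  interpret T: nonassoc_algebra K ?T
    by (rule nonassoc_algebra_free_algebra) fact
  note bilin = T.mult_add_left T.mult_add_right T.mult_smult_left T.mult_smult_right
  have one: "\<one>\<^bsub>?T\<^esub> = basis_elem K []" by (simp add: free_algebra_def)
  have one_closed: "\<one>\<^bsub>?T\<^esub> \<in> carrier ?T" by (simp add: one)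
  have "\<one>\<^bsub>?T\<^esub> \<otimes>\<^bsub>?T\<^esub> f = f" "f \<otimes>\<^bsub>?T\<^esub> \<one>\<^bsub>?T\<^esub> = f" if "f \<in> carrier ?T" for f
    using that one_closed
    by (induction rule: finsupp_induct) (simp_all add: bilin, simp_all add: one basis_mult_free_algebra)
  moreover have "(f \<otimes>\<^bsub>?T\<^esub> g) \<otimes>\<^bsub>?T\<^esub> h = f \<otimes>\<^bsub>?T\<^esub> (g \<otimes>\<^bsub>?T\<^esub> h)"
    if f: "f \<in> carrier ?T" and g: "g \<in> carrier ?T" and h: "h \<in> carrier ?T" for f g h
    using f
  proof (induction f rule: finsupp_induct)
    case (basis u)
    then have u: "basis_elem K u \<in> carrier ?T" by simp
    from g show ?case
    proof (induction g rule: finsupp_induct)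
      case (basis v)
      then have v: "basis_elem K v \<in> carrier ?T" by simp
      from h show ?case
      proof (induction h rule: finsupp_induct)
        case (basis w)
        show ?case by (simp add: basis_mult_free_algebra)
      qed (use u v in \<open>auto simp: bilin\<close>)
    qed (use u h in \<open>auto simp: bilin\<close>)
  qed (use g h in \<open>auto simp: bilin\<close>)
  ultimately show ?thesis
    using one_closed T.nonassoc_algebra_axioms
    by (simp add: assoc_algebra_def assoc_algebra_axioms_def)
qed

abbreviation word_product :: "('k, 'b) module \<Rightarrow> ('x \<Rightarrow> 'b) \<Rightarrow> 'x list \<Rightarrow> 'b"
  where "word_product B f w \<equiv> foldr (\<lambda>x b. f x \<otimes>\<^bsub>B\<^esub> b) w \<one>\<^bsub>B\<^esub>"

locale free_algebra_target = B: assoc_algebra K B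
  for K :: "('k, 'm) ring_scheme" and B :: "('k, 'b) module" +
  fixes S :: "'x set" and f :: "'x \<Rightarrow> 'b"
  assumes f_closed: "x \<in> S \<Longrightarrow> f x \<in> carrier B"
begin

lemma word_product_closed: "w \<in> lists S \<Longrightarrow> word_product B f w \<in> carrier B"
  by (induction w) (auto simp: f_closed)

lemma word_product_append:
  "\<lbrakk>u \<in> lists S; v \<in> lists S\<rbrakk> \<Longrightarrow>
    word_product B f (u @ v) = word_product B f u \<otimes>\<^bsub>B\<^esub> word_product B f v"
proof (induction u)
  case Nil
  then show ?case using word_product_closed by simp
next
  case (Cons x u)
  then show ?case using f_closed word_product_closed by (simp add: B.A.m_assoc)
qed

sublocale T: assoc_algebra K "free_algebra K S"
  by (rule assoc_algebra_free_algebra) (rule B.R.cring_axioms)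

sublocale ext: finsupp_extension K "lists S" "free_algebra K S" B "word_product B f"
  by (intro finsupp_extension.intro finsupp_module_free_algebra B.R.cring_axioms B.module_axioms)
    (use word_product_closed in \<open>auto simp: finsupp_extension_axioms_def\<close>)

lemma free_algebra_lift_eq: "free_algebra_lift K B f = linear_extension K B (word_product B f)"
  by (auto simp: free_algebra_lift_def linear_extension_def)

lemma free_algebra_lift_basis:
  "w \<in> lists S \<Longrightarrow> free_algebra_lift K B f (basis_elem K w) = word_product B f w"
  by (simp add: free_algebra_lift_eq ext.linear_extension_basis)

lemma free_algebra_lift_gen: "x \<in> S \<Longrightarrow> free_algebra_lift K B f (basis_elem K [x]) = f x"
  by (simp add: free_algebra_lift_basis f_closed)

lemma free_algebra_lift_one: "free_algebra_lift K B f \<one>\<^bsub>free_algebra K S\<^esub> = \<one>\<^bsub>B\<^esub>"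
  using free_algebra_lift_basis[of "[]"] by (simp add: free_algebra_def)

lemma algebra_map_free_algebra_lift: "algebra_map K (free_algebra K S) B (free_algebra_lift K B f)"
proof -
  have "linear_extension K B (word_product B f) (a \<otimes>\<^bsub>free_algebra K S\<^esub> b) =
      linear_extension K B (word_product B f) a \<otimes>\<^bsub>B\<^esub> linear_extension K B (word_product B f) b"
    if "a \<in> carrier (free_algebra K S)" "b \<in> carrier (free_algebra K S)" for a b
    using that
    by (intro ext.linear_extension_mult T.nonassoc_algebra_axioms B.nonassoc_algebra_axioms)
      (auto simp: B.R.basis_mult_free_algebra ext.linear_extension_basis word_product_append simp del: foldr_append)
  then show ?thesis unfolding free_algebra_lift_eq
    by (intro algebra_mapI ext.linear_extension_closed ext.linear_extension_add ext.linear_extension_smult)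
qed

sublocale lift: nonassoc_algebra_map K "free_algebra K S" B "free_algebra_lift K B f"
  by unfold_locales (rule algebra_map_free_algebra_lift)

end

section \<open>Enveloping algebras\<close>

lemma algebra_hom_iff: "h \<in> algebra_hom K A B \<longleftrightarrow> algebra_map K A B h \<and> h \<one>\<^bsub>A\<^esub> = \<one>\<^bsub>B\<^esub>"
  by (auto simp: algebra_hom_def algebra_map_def ring_hom_def)

lemma (in free_algebra_target) free_algebra_lift_comp:
  assumes C: "assoc_algebra K C" and g: "algebra_map K B C g" "g \<one>\<^bsub>B\<^esub> = \<one>\<^bsub>C\<^esub>"
    and f': "\<And>x. x \<in> S \<Longrightarrow> f' x = g (f x)"
    and a: "a \<in> carrier (free_algebra K S)"
  shows "free_algebra_lift K C f' a = g (free_algebra_lift K B f a)"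
proof -
  interpret C: assoc_algebra K C by fact
  interpret g: nonassoc_algebra_map K B C g by unfold_locales fact
  interpret C: free_algebra_target K C S f'
    by unfold_locales (auto simp: f' f_closed)
  have word: "word_product C f' w = g (word_product B f w)" if "w \<in> lists S" for w
    using that by (induction w) (auto simp: g f' g.mult f_closed word_product_closed)
  from a show ?thesis
  proof (induction rule: ext.finsupp_induct)
    case (basis w)
    then show ?case
      using word by (simp add: free_algebra_lift_basis C.free_algebra_lift_basis)
  qed (auto simp: C.lift.add lift.add C.lift.smult lift.smult g.add g.smult)
qed

locale enveloping_algebra = L: nonassoc_algebra K L
  for K :: "('k, 'm) ring_scheme" and L :: "('k, 'a) module"
begin

abbreviation "T \<equiv> free_algebra K (carrier L)"

sublocale T: assoc_algebra K T
  by (rule assoc_algebra_free_algebra) (rule L.R.cring_axioms)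

sublocale FT: finsupp_module K "lists (carrier L)" T
  by (rule finsupp_module_free_algebra) (rule L.R.cring_axioms)

lemma gen_closed [simp]: "x \<in> carrier L \<Longrightarrow> basis_elem K [x] \<in> carrier T"
  by simp

lemma enveloping_relators_closed: "enveloping_relators K L \<subseteq> carrier T"
  by (auto simp: enveloping_relators_def Let_def simp del: FT.basis_closed)

lemma ideal_enveloping: "Ideal.ideal (enveloping_ideal K L) T"
  unfolding enveloping_ideal_def
  by (rule T.A.genideal_ideal) (rule enveloping_relators_closed)

lemma enveloping_relators_in_ideal: "enveloping_relators K L \<subseteq> enveloping_ideal K L"
  unfolding enveloping_ideal_def
  by (rule T.A.genideal_self) (rule enveloping_relators_closed)

sublocale U: algebra_quotient K T "enveloping_ideal K L"
  by unfold_locales (rule T.ideal_imp_algebra_ideal[OF ideal_enveloping])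

lemma assoc_algebra_enveloping: "assoc_algebra K (enveloping K L)"
  unfolding enveloping_def
  by (rule assoc_algebra_quotient[OF T.assoc_algebra_axioms U.ideal])

lemma enveloping_incl_closed: "x \<in> carrier L \<Longrightarrow> enveloping_incl K L x \<in> carrier (enveloping K L)"
  by (simp add: enveloping_incl_def enveloping_def)

text \<open>
  The three families of relators say exactly that the inclusion of \<open>L\<close> into \<open>U(L)\<close> is additive,
  homogeneous and compatible with brackets.
\<close>

lemma algebra_map_enveloping_incl:
  "algebra_map K L (commutator_algebra (enveloping K L)) (enveloping_incl K L)"
proof -
  interpret E: assoc_algebra K "enveloping K L" by (rule assoc_algebra_enveloping)
  interpret pr: nonassoc_algebra_map K T "enveloping K L"
      "\<lambda>t. enveloping_ideal K L +>\<^bsub>T\<^esub> t"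
    by unfold_locales (simp add: enveloping_def U.algebra_map_proj)
  have eq: "enveloping_ideal K L +>\<^bsub>T\<^esub> s = enveloping_ideal K L +>\<^bsub>T\<^esub> t"
    if "s \<in> carrier T" "t \<in> carrier T" "t \<ominus>\<^bsub>T\<^esub> s \<in> enveloping_relators K L" for s t
    using that enveloping_relators_in_ideal U.coset_eq_if_minus[of t s] by auto
  have rel: "\<lbrakk>x \<in> carrier L; y \<in> carrier L\<rbrakk> \<Longrightarrow>
      basis_elem K [x \<oplus>\<^bsub>L\<^esub> y] \<ominus>\<^bsub>T\<^esub> (basis_elem K [x] \<oplus>\<^bsub>T\<^esub> basis_elem K [y]) \<in> enveloping_relators K L"
    "\<lbrakk>c \<in> carrier K; x \<in> carrier L\<rbrakk> \<Longrightarrow>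
      basis_elem K [c \<odot>\<^bsub>L\<^esub> x] \<ominus>\<^bsub>T\<^esub> c \<odot>\<^bsub>T\<^esub> basis_elem K [x] \<in> enveloping_relators K L"
    "\<lbrakk>x \<in> carrier L; y \<in> carrier L\<rbrakk> \<Longrightarrow>
      (basis_elem K [x] \<otimes>\<^bsub>T\<^esub> basis_elem K [y] \<ominus>\<^bsub>T\<^esub> basis_elem K [y] \<otimes>\<^bsub>T\<^esub> basis_elem K [x])
        \<ominus>\<^bsub>T\<^esub> basis_elem K [x \<otimes>\<^bsub>L\<^esub> y] \<in> enveloping_relators K L" for x y c
    by (auto simp: enveloping_relators_def Let_def)
  show ?thesis
  proof (rule algebra_mapI; simp only: commutator_algebra_simps enveloping_incl_closed)
    fix x y assume xy: "x \<in> carrier L" "y \<in> carrier L"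
    show "enveloping_incl K L (x \<oplus>\<^bsub>L\<^esub> y) =
        enveloping_incl K L x \<oplus>\<^bsub>enveloping K L\<^esub> enveloping_incl K L y"
      using xy rel(1)[OF xy]
        eq[of "basis_elem K [x] \<oplus>\<^bsub>T\<^esub> basis_elem K [y]" "basis_elem K [x \<oplus>\<^bsub>L\<^esub> y]"]
      by (simp add: enveloping_incl_def pr.add)
    show "enveloping_incl K L (x \<otimes>\<^bsub>L\<^esub> y) =
        enveloping_incl K L x \<otimes>\<^bsub>enveloping K L\<^esub> enveloping_incl K L y \<ominus>\<^bsub>enveloping K L\<^esub>
        enveloping_incl K L y \<otimes>\<^bsub>enveloping K L\<^esub> enveloping_incl K L x"
      using xy rel(3)[OF xy] eq[of "basis_elem K [x \<otimes>\<^bsub>L\<^esub> y]"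
        "basis_elem K [x] \<otimes>\<^bsub>T\<^esub> basis_elem K [y] \<ominus>\<^bsub>T\<^esub> basis_elem K [y] \<otimes>\<^bsub>T\<^esub> basis_elem K [x]"]
      by (simp add: enveloping_incl_def pr.mult pr.minus T.M.minus_closed)
  next
    fix c x assume cx: "c \<in> carrier K" "x \<in> carrier L"
    show "enveloping_incl K L (c \<odot>\<^bsub>L\<^esub> x) = c \<odot>\<^bsub>enveloping K L\<^esub> enveloping_incl K L x"
      using cx rel(2)[OF cx]
        eq[of "c \<odot>\<^bsub>T\<^esub> basis_elem K [x]" "basis_elem K [c \<odot>\<^bsub>L\<^esub> x]"]
      by (simp add: enveloping_incl_def pr.smult)
  qed
qed

end

text \<open>The universal property of \<open>U(L)\<close>.\<close>

locale enveloping_target = enveloping_algebra K L + B: assoc_algebra K B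
  for K :: "('k, 'm) ring_scheme" and L :: "('k, 'a) module" and B :: "('k, 'b) module" +
  fixes f :: "'a \<Rightarrow> 'b"
  assumes f: "algebra_map K L (commutator_algebra B) f"
begin

lemma f_closed: "x \<in> carrier L \<Longrightarrow> f x \<in> carrier B"
  and f_add: "\<lbrakk>x \<in> carrier L; y \<in> carrier L\<rbrakk> \<Longrightarrow> f (x \<oplus>\<^bsub>L\<^esub> y) = f x \<oplus>\<^bsub>B\<^esub> f y"
  and f_smult: "\<lbrakk>c \<in> carrier K; x \<in> carrier L\<rbrakk> \<Longrightarrow> f (c \<odot>\<^bsub>L\<^esub> x) = c \<odot>\<^bsub>B\<^esub> f x"
  and f_bracket: "\<lbrakk>x \<in> carrier L; y \<in> carrier L\<rbrakk> \<Longrightarrow>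
    f (x \<otimes>\<^bsub>L\<^esub> y) = f x \<otimes>\<^bsub>B\<^esub> f y \<ominus>\<^bsub>B\<^esub> f y \<otimes>\<^bsub>B\<^esub> f x"
  using f by (auto simp: algebra_map_def)

sublocale F: free_algebra_target K B "carrier L" f
  by unfold_locales (rule f_closed)

lemma kills_enveloping_ideal:
  assumes "t \<in> enveloping_ideal K L"
  shows "free_algebra_lift K B f t = \<zero>\<^bsub>B\<^esub>"
proof -
  let ?h = "free_algebra_lift K B f"
  have gen: "?h (basis_elem K [x]) = f x" if "x \<in> carrier L" for x
    using that by (rule F.free_algebra_lift_gen)
  note lin = F.lift.minus F.lift.add F.lift.smult F.lift.mult gen f_add f_smult f_bracket
  have "enveloping_relators K L \<subseteq> {t \<in> carrier T. ?h t = \<zero>\<^bsub>B\<^esub>}"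
    using enveloping_relators_closed
    by (auto simp: enveloping_relators_def Let_def lin f_closed B.minus_self)
  moreover have "Ideal.ideal {t \<in> carrier T. ?h t = \<zero>\<^bsub>B\<^esub>} T"
    by (rule T.algebra_ideal_imp_ideal) (rule F.lift.kernel_ideal)
  ultimately have "enveloping_ideal K L \<subseteq> {t \<in> carrier T. ?h t = \<zero>\<^bsub>B\<^esub>}"
    unfolding enveloping_ideal_def by (rule T.A.genideal_minimal[rotated])
  then show ?thesis using assms by auto
qed

sublocale Q: quotient_lift K T B "free_algebra_lift K B f" "enveloping_ideal K L"
  by unfold_locales (rule kills_enveloping_ideal)

lemma enveloping_lift_coset:
  "t \<in> carrier T \<Longrightarrow> enveloping_lift K B f (enveloping_ideal K L +>\<^bsub>T\<^esub> t) = free_algebra_lift K B f t"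
  unfolding enveloping_lift_def by (rule Q.lift_coset)

lemma enveloping_lift_incl: "x \<in> carrier L \<Longrightarrow> enveloping_lift K B f (enveloping_incl K L x) = f x"
  by (simp add: enveloping_incl_def enveloping_lift_coset F.free_algebra_lift_gen)

lemma enveloping_lift_hom: "enveloping_lift K B f \<in> algebra_hom K (enveloping K L) B"
proof -
  have "enveloping_lift K B f = (\<lambda>Z. the_elem (free_algebra_lift K B f ` Z))"
    by (simp add: enveloping_lift_def fun_eq_iff)
  then have "algebra_map K (enveloping K L) B (enveloping_lift K B f)"
    using Q.algebra_map_lift by (simp add: enveloping_def)
  moreover have "enveloping_lift K B f \<one>\<^bsub>enveloping K L\<^esub> = \<one>\<^bsub>B\<^esub>"
    using enveloping_lift_coset[of "\<one>\<^bsub>T\<^esub>"]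
    by (simp add: enveloping_def F.free_algebra_lift_one flip: U.proj_one)
  ultimately show ?thesis by (simp add: algebra_hom_iff)
qed

text \<open>
  Homomorphisms on \<open>U(L)\<close> are determined by their values on \<open>L\<close>, here for the composition of \<open>g\<close>
  with the homomorphism induced by \<open>f\<close>.
\<close>

lemma enveloping_lift_comp:
  assumes C: "assoc_algebra K C" and g: "g \<in> algebra_hom K B C"
    and f': "\<And>x. x \<in> carrier L \<Longrightarrow> f' x = g (f x)"
    and u: "u \<in> carrier (enveloping K L)"
  shows "enveloping_lift K C f' u = g (enveloping_lift K B f u)"
proof -
  interpret C: assoc_algebra K C by fact
  have g1: "algebra_map K B C g" "g \<one>\<^bsub>B\<^esub> = \<one>\<^bsub>C\<^esub>" using g by (auto simp: algebra_hom_iff)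
  have "algebra_map K L (commutator_algebra C) (\<lambda>x. g (f x))"
    by (rule algebra_map_comp[OF f B.algebra_map_commutator[OF C g1(1)]])
  then have "algebra_map K L (commutator_algebra C) f'"
    by (auto simp: algebra_map_def f')
  then interpret C: enveloping_target K L C f'
    by unfold_locales
  obtain t where t: "t \<in> carrier T" "u = enveloping_ideal K L +>\<^bsub>T\<^esub> t"
    using u by (auto simp: enveloping_def elim: U.quotient_carrierE)
  then show ?thesis
    using F.free_algebra_lift_comp[OF C g1 f']
    by (simp add: enveloping_lift_coset C.enveloping_lift_coset)
qed

end

text \<open>
  If \<open>f\<close> vanishes on \<open>C\<close>, it induces a map on \<open>L/C\<close> and hence \<open>\<psi>\<close> on \<open>U(L/C)\<close>.  That the
  homomorphism on \<open>U(L)\<close> factors through \<open>\<psi>\<close> is the uniqueness above, since the canonical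
  projection is itself induced by the map \<open>L \<rightarrow> L/C \<rightarrow> U(L/C)\<close>.
\<close>

lemma enveloping_lift_quotient:
  assumes L: "nonassoc_algebra K L" and B: "assoc_algebra K B"
    and f: "algebra_map K L (commutator_algebra B) f"
    and C: "algebra_ideal K L C" and f_C: "\<And>x. x \<in> C \<Longrightarrow> f x = \<zero>\<^bsub>B\<^esub>"
  obtains \<psi> where "\<psi> \<in> algebra_hom K (enveloping K (quotient_algebra L C)) B"
    and "\<And>u. u \<in> carrier (enveloping K L) \<Longrightarrow> enveloping_lift K B f u = \<psi> (enveloping_proj K L C u)"
    and "\<And>u. u \<in> carrier (enveloping K L) \<Longrightarrow>
      enveloping_proj K L C u \<in> carrier (enveloping K (quotient_algebra L C))"
proof -
  let ?L' = "quotient_algebra L C"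
  interpret L: nonassoc_algebra K L by fact
  interpret B: assoc_algebra K B by fact
  interpret BL: nonassoc_algebra K "commutator_algebra B" by (rule B.nonassoc_algebra_commutator)
  interpret quotient_lift K L "commutator_algebra B" f C
    by unfold_locales (use f C f_C in auto)
  interpret L': nonassoc_algebra K ?L' by (rule nonassoc_algebra_quotient)
  let ?f' = "\<lambda>Z. the_elem (f ` Z)"
  interpret \<psi>: enveloping_target K ?L' B ?f'
    by unfold_locales (rule algebra_map_lift)
  interpret E': assoc_algebra K "enveloping K ?L'" by (rule \<psi>.assoc_algebra_enveloping)
  let ?g = "\<lambda>x. enveloping_incl K ?L' (C +>\<^bsub>L\<^esub> x)"
  have "algebra_map K L (commutator_algebra (enveloping K ?L')) ?g"
    by (rule algebra_map_comp[OF algebra_map_proj \<psi>.algebra_map_enveloping_incl])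
  then interpret pr: enveloping_target K L "enveloping K ?L'" ?g
    by unfold_locales
  have proj: "enveloping_proj K L C = enveloping_lift K (enveloping K ?L') ?g"
    by (simp add: enveloping_proj_def)
  show thesis
  proof
    show "enveloping_lift K B ?f' \<in> algebra_hom K (enveloping K ?L') B"
      by (rule \<psi>.enveloping_lift_hom)
    fix u assume u: "u \<in> carrier (enveloping K L)"
    show "enveloping_lift K B f u = enveloping_lift K B ?f' (enveloping_proj K L C u)"
      unfolding proj
      by (rule pr.enveloping_lift_comp[OF B.assoc_algebra_axioms \<psi>.enveloping_lift_hom _ u])
        (simp add: \<psi>.enveloping_lift_incl lift_coset)
    show "enveloping_proj K L C u \<in> carrier (enveloping K ?L')"
      using u pr.enveloping_lift_hom by (simp add: proj algebra_hom_iff algebra_map_def)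
  qed
qed

definition unital_subalgebra :: "('k, 'm) ring_scheme \<Rightarrow> ('k, 'a) module \<Rightarrow> 'a set \<Rightarrow> bool"
  where "unital_subalgebra K A H \<longleftrightarrow> submodule H K A \<and> \<one>\<^bsub>A\<^esub> \<in> H \<and> (\<forall>x\<in>H. \<forall>y\<in>H. x \<otimes>\<^bsub>A\<^esub> y \<in> H)"

lemma unital_subalgebra_image:
  assumes A: "assoc_algebra K A" and B: "assoc_algebra K B" and h: "h \<in> algebra_hom K A B"
  shows "unital_subalgebra K B (h ` carrier A)"
proof -
  interpret A: assoc_algebra K A by fact
  interpret B: assoc_algebra K B by fact
  interpret nonassoc_algebra_map K A B h
    by unfold_locales (use h in \<open>auto simp: algebra_hom_iff\<close>)
  have "submodule (h ` carrier A) K B"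
    by (rule B.submodule_closedI) (auto intro: image_eqI[of _ _ "\<zero>\<^bsub>A\<^esub>"] simp flip: add smult)
  moreover have "\<one>\<^bsub>B\<^esub> \<in> h ` carrier A"
    using h A.A.one_closed by (auto simp: algebra_hom_iff intro!: image_eqI[of _ _ "\<one>\<^bsub>A\<^esub>"])
  ultimately show ?thesis
    by (auto simp: unital_subalgebra_def simp flip: mult)
qed

lemma free_algebra_quotient_generated:
  assumes K: "cring K" and J: "algebra_ideal K (free_algebra K S) J"
    and H: "unital_subalgebra K (quotient_algebra (free_algebra K S) J) H"
    and gens: "\<And>x. x \<in> S \<Longrightarrow> J +>\<^bsub>free_algebra K S\<^esub> basis_elem K [x] \<in> H"
  shows "H = carrier (quotient_algebra (free_algebra K S) J)"
proof -
  let ?T = "free_algebra K S"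
  interpret T: assoc_algebra K ?T by (rule assoc_algebra_free_algebra[OF K])
  interpret FT: finsupp_module K "lists S" ?T by (rule finsupp_module_free_algebra[OF K])
  interpret Q: algebra_quotient K ?T J by unfold_locales (rule J)
  interpret QA: nonassoc_algebra K "quotient_algebra ?T J" by (rule Q.nonassoc_algebra_quotient)
  have sub: "submodule H K (quotient_algebra ?T J)" and one: "\<one>\<^bsub>quotient_algebra ?T J\<^esub> \<in> H"
    and mult: "\<And>x y. \<lbrakk>x \<in> H; y \<in> H\<rbrakk> \<Longrightarrow> x \<otimes>\<^bsub>quotient_algebra ?T J\<^esub> y \<in> H"
    using H by (auto simp: unital_subalgebra_def)
  have word: "J +>\<^bsub>?T\<^esub> basis_elem K w \<in> H" if "w \<in> lists S" for w
    using that
  proof (induction w)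
    case Nil
    have "\<one>\<^bsub>?T\<^esub> = basis_elem K []" by (simp add: free_algebra_def)
    then have "J +>\<^bsub>?T\<^esub> basis_elem K [] = \<one>\<^bsub>quotient_algebra ?T J\<^esub>"
      using Q.proj_one by simp
    then show ?case using one by simp
  next
    case (Cons x w)
    have "basis_elem K (x # w) = basis_elem K [x] \<otimes>\<^bsub>?T\<^esub> basis_elem K w"
      by (simp add: T.R.basis_mult_free_algebra)
    then show ?case using Cons gens mult by (simp add: Q.proj_mult)
  qed
  have "J +>\<^bsub>?T\<^esub> t \<in> H" if "t \<in> carrier ?T" for t
    using that
  proof (induction rule: FT.finsupp_induct)
    case zero
    then show ?case
      using subgroup.one_closed[OF submodule.axioms(1)[OF sub]] by (simp add: Q.proj_zero)
  qed (use QA.submoduleE[OF sub] word in \<open>auto simp: Q.proj_add Q.proj_smult\<close>)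
  then show ?thesis
    using QA.submoduleE(1)[OF sub] by (auto elim!: Q.quotient_carrierE)
qed

section \<open>Lie algebras\<close>

locale lie_algebra = nonassoc_algebra K A
  for K :: "('k, 'm) ring_scheme" and A :: "('k, 'a) module" +
  assumes alternating: "x \<in> carrier A \<Longrightarrow> x \<otimes>\<^bsub>A\<^esub> x = \<zero>\<^bsub>A\<^esub>"
    and Jacobi: "\<lbrakk>x \<in> carrier A; y \<in> carrier A; z \<in> carrier A\<rbrakk> \<Longrightarrow>
      x \<otimes>\<^bsub>A\<^esub> (y \<otimes>\<^bsub>A\<^esub> z) \<oplus>\<^bsub>A\<^esub> y \<otimes>\<^bsub>A\<^esub> (z \<otimes>\<^bsub>A\<^esub> x) \<oplus>\<^bsub>A\<^esub> z \<otimes>\<^bsub>A\<^esub> (x \<otimes>\<^bsub>A\<^esub> y) = \<zero>\<^bsub>A\<^esub>"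

lemma (in assoc_algebra) lie_algebra_commutator: "lie_algebra K (commutator_algebra A)"
proof (intro lie_algebra.intro nonassoc_algebra_commutator lie_algebra_axioms.intro)
  fix x assume "x \<in> carrier (commutator_algebra A)"
  then show "x \<otimes>\<^bsub>commutator_algebra A\<^esub> x = \<zero>\<^bsub>commutator_algebra A\<^esub>"
    by (simp add: minus_self)
next
  fix x y z
  assume "x \<in> carrier (commutator_algebra A)" "y \<in> carrier (commutator_algebra A)"
    "z \<in> carrier (commutator_algebra A)"
  then show "x \<otimes>\<^bsub>commutator_algebra A\<^esub> (y \<otimes>\<^bsub>commutator_algebra A\<^esub> z) \<oplus>\<^bsub>commutator_algebra A\<^esub>
      y \<otimes>\<^bsub>commutator_algebra A\<^esub> (z \<otimes>\<^bsub>commutator_algebra A\<^esub> x) \<oplus>\<^bsub>commutator_algebra A\<^esub>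
      z \<otimes>\<^bsub>commutator_algebra A\<^esub> (x \<otimes>\<^bsub>commutator_algebra A\<^esub> y) = \<zero>\<^bsub>commutator_algebra A\<^esub>"
    using commutator_Jacobi[of x y z] by (simp only: commutator_algebra_simps(1-3))
qed

lemma (in lie_algebra) lie_algebra_quotient:
  assumes "algebra_ideal K A I"
  shows "lie_algebra K (quotient_algebra A I)"
proof -
  interpret algebra_quotient K A I by unfold_locales fact
  show ?thesis
    by (intro lie_algebra.intro nonassoc_algebra_quotient lie_algebra_axioms.intro)
      (auto elim!: quotient_carrierE simp: alternating Jacobi simp flip: proj_mult proj_add proj_zero)
qed

lemma (in lie_algebra) anticommutative:
  assumes xy: "x \<in> carrier A" "y \<in> carrier A"
  shows "y \<otimes>\<^bsub>A\<^esub> x = \<ominus>\<^bsub>A\<^esub> (x \<otimes>\<^bsub>A\<^esub> y)"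
proof -
  have "(x \<oplus>\<^bsub>A\<^esub> y) \<otimes>\<^bsub>A\<^esub> (x \<oplus>\<^bsub>A\<^esub> y) =
      (x \<otimes>\<^bsub>A\<^esub> x \<oplus>\<^bsub>A\<^esub> y \<otimes>\<^bsub>A\<^esub> x) \<oplus>\<^bsub>A\<^esub> (x \<otimes>\<^bsub>A\<^esub> y \<oplus>\<^bsub>A\<^esub> y \<otimes>\<^bsub>A\<^esub> y)"
    using xy by (simp add: mult_add_left mult_add_right)
  then have "y \<otimes>\<^bsub>A\<^esub> x \<oplus>\<^bsub>A\<^esub> x \<otimes>\<^bsub>A\<^esub> y = \<zero>\<^bsub>A\<^esub>" using alternating xy by simp
  then show ?thesis using xy M.minus_equality by simp
qed

text \<open>
  The terms decrease, so \<open>[L, C\<^sup>m] \<subseteq> C\<^bsup>m+1\<^esup> \<subseteq> C\<^sup>m\<close>; anticommutativity gives the other side.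
\<close>

lemma (in lie_algebra) lower_central_ideal:
  "algebra_ideal K A (lower_central K A m)"
proof -
  have sub: "submodule (lower_central K A m) K A" for m
  proof (induction m)
    case 0
    then show ?case using carrier_is_submodule by simp
  next
    case (Suc m)
    then show ?case
      using submoduleE(1)[OF Suc] by (auto intro!: submodule_hull)
  qed
  have dec: "lower_central K A (Suc m) \<subseteq> lower_central K A m" for m
  proof (induction m)
    case 0
    then show ?case using submoduleE(1)[OF sub[of "Suc 0"]] by simp
  next
    case (Suc m)
    show ?case
      unfolding lower_central.simps(2)[of K A "Suc m"] lower_central.simps(2)[of K A m]
      by (rule hull_mono) (use Suc in auto)
  qed
  have left: "x \<otimes>\<^bsub>A\<^esub> y \<in> lower_central K A m"
    if "x \<in> carrier A" "y \<in> lower_central K A m" for x y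
  proof -
    have "x \<otimes>\<^bsub>A\<^esub> y \<in> lower_central K A (Suc m)"
      using that by (auto intro!: hull_inc)
    then show ?thesis using dec by blast
  qed
  have "y \<otimes>\<^bsub>A\<^esub> x \<in> lower_central K A m"
    if xy: "x \<in> carrier A" "y \<in> lower_central K A m" for x y
  proof -
    have "y \<in> carrier A" using submoduleE(1)[OF sub] xy by blast
    then show ?thesis
      using anticommutative[OF xy(1) \<open>y \<in> carrier A\<close>] left[OF xy] submoduleE(3)[OF sub] xy by simp
  qed
  then show ?thesis
    using sub left by (simp add: algebra_ideal_def)
qed

text \<open>
  The preimage of \<open>G (m + 1)\<close> is a submodule, and by induction it contains all the brackets whose span
  is the next term of the lower central series.
\<close>

lemma (in nonassoc_algebra_map) lower_central_image:
  assumes sub: "\<And>m. submodule (G m) K B"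
    and G0: "h ` carrier A \<subseteq> G 0"
    and G_mult: "\<And>x y m. \<lbrakk>x \<in> G 0; y \<in> G m\<rbrakk> \<Longrightarrow> x \<otimes>\<^bsub>B\<^esub> y \<in> G (Suc m)"
  shows "h ` lower_central K A m \<subseteq> G m"
proof (induction m)
  case 0
  then show ?case using G0 by simp
next
  case (Suc m)
  have "lower_central K A m \<subseteq> carrier A"
  proof (induction m)
    case (Suc m)
    then show ?case
      by (subst lower_central.simps, intro A.submoduleE(1)[OF A.submodule_hull]) auto
  qed simp
  then have "{x \<otimes>\<^bsub>A\<^esub> y | x y. x \<in> carrier A \<and> y \<in> lower_central K A m} \<subseteq>
      {x \<in> carrier A. h x \<in> G (Suc m)}"
    using Suc G0 by (force simp: mult intro!: G_mult)
  then have "lower_central K A (Suc m) \<subseteq> {x \<in> carrier A. h x \<in> G (Suc m)}"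
    unfolding lower_central.simps by (intro hull_minimal vimage_submodule sub)
  then show ?case by auto
qed

context nonassoc_algebra
begin

text \<open>
  When the product of \<open>Y i\<close> and \<open>Y k\<close> only involves an index beyond both \<open>i\<close> and \<open>k\<close>, multiplication
  by any element of the span of the \<open>Y j\<close> pushes the tail spans one step down.  Once the sequence
  \<open>Y\<close> vanishes from some index on, the filtration reaches zero there.
\<close>

lemma triangular_filtration:
  fixes Y :: "nat \<Rightarrow> 'a"
  defines "G \<equiv> \<lambda>m. (\<lambda>H. submodule H K A) hull {Y j | j. m \<le> j}"
  assumes Y: "\<And>j. Y j \<in> carrier A"
    and triangular: "\<And>i k. \<exists>c\<in>carrier K. \<exists>j>max i k. Y i \<otimes>\<^bsub>A\<^esub> Y k = c \<odot>\<^bsub>A\<^esub> Y j"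
  shows "submodule (G m) K A"
    and "\<lbrakk>x \<in> G 0; y \<in> G m\<rbrakk> \<Longrightarrow> x \<otimes>\<^bsub>A\<^esub> y \<in> G (Suc m)"
    and "(\<And>j. j \<ge> m \<Longrightarrow> Y j = \<zero>\<^bsub>A\<^esub>) \<Longrightarrow> G m = {\<zero>\<^bsub>A\<^esub>}"
proof -
  have G_eq: "G m = (\<lambda>H. submodule H K A) hull {Y j | j. m \<le> j}" for m
    by (simp add: G_def)
  have sub: "submodule (G m) K A" for m
    unfolding G_eq by (rule submodule_hull) (use Y in auto)
  then show "submodule (G m) K A" .
  note G = submoduleE[OF sub]
  have zero: "\<zero>\<^bsub>A\<^esub> \<in> G m" for m
    using subgroup.one_closed[OF submodule.axioms(1)[OF sub]] by simp
  have Y_G: "Y j \<in> G m" if "m \<le> j" for j m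
    unfolding G_eq using that by (auto intro: hull_inc)
  have Y_mult: "Y i \<otimes>\<^bsub>A\<^esub> y \<in> G (Suc m)" if "y \<in> G m" for i y m
  proof -
    have "G m \<subseteq> {y \<in> carrier A. Y i \<otimes>\<^bsub>A\<^esub> y \<in> G (Suc m)}"
      unfolding G_eq[of m]
    proof (rule hull_minimal)
      have "Y i \<otimes>\<^bsub>A\<^esub> Y k \<in> G (Suc m)" if "m \<le> k" for k
      proof -
        obtain c j where "c \<in> carrier K" "j > max i k" "Y i \<otimes>\<^bsub>A\<^esub> Y k = c \<odot>\<^bsub>A\<^esub> Y j"
          using triangular by blast
        then show ?thesis using that Y_G[of "Suc m" j] G(4) by auto
      qed
      then show "{Y j | j. m \<le> j} \<subseteq> {y \<in> carrier A. Y i \<otimes>\<^bsub>A\<^esub> y \<in> G (Suc m)}"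
        using Y by auto
      show "submodule {y \<in> carrier A. Y i \<otimes>\<^bsub>A\<^esub> y \<in> G (Suc m)} K A"
        by (rule submodule_closedI) (use Y zero G in \<open>auto simp: mult_add_right mult_smult_right\<close>)
    qed
    then show ?thesis using that by blast
  qed
  show "x \<otimes>\<^bsub>A\<^esub> y \<in> G (Suc m)" if "x \<in> G 0" "y \<in> G m" for x y m
  proof -
    have y: "y \<in> carrier A" using that G(1) by blast
    have "G 0 \<subseteq> {x \<in> carrier A. x \<otimes>\<^bsub>A\<^esub> y \<in> G (Suc m)}"
      unfolding G_eq[of 0]
    proof (rule hull_minimal)
      show "{Y j | j. 0 \<le> j} \<subseteq> {x \<in> carrier A. x \<otimes>\<^bsub>A\<^esub> y \<in> G (Suc m)}"
        using Y Y_mult that by auto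
      show "submodule {x \<in> carrier A. x \<otimes>\<^bsub>A\<^esub> y \<in> G (Suc m)} K A"
        by (rule submodule_closedI) (use y zero G in \<open>auto simp: mult_add_left mult_smult_left\<close>)
    qed
    then show ?thesis using that by blast
  qed
  show "G m = {\<zero>\<^bsub>A\<^esub>}" if "\<And>j. j \<ge> m \<Longrightarrow> Y j = \<zero>\<^bsub>A\<^esub>"
  proof -
    have "submodule {\<zero>\<^bsub>A\<^esub>} K A"
      by (rule submodule_closedI) auto
    then have "G m \<subseteq> {\<zero>\<^bsub>A\<^esub>}"
      unfolding G_eq using that by (intro hull_minimal) auto
    then show ?thesis using zero by blast
  qed
qed

end

section \<open>Free Lie algebras and Yang--Mills algebras\<close>

lemma lie_relators_subset:
  assumes "nonassoc_algebra K A"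
  shows "lie_relators A \<subseteq> carrier A"
proof -
  interpret nonassoc_algebra K A by fact
  show ?thesis by (auto simp: lie_relators_def)
qed

lemma free_lie_ideal_ideal:
  assumes "cring K"
  shows "algebra_ideal K (free_nonassoc K S) (free_lie_ideal K S)"
proof -
  interpret nonassoc_algebra K "free_nonassoc K S" by (rule nonassoc_algebra_free_nonassoc) fact
  show ?thesis
    unfolding free_lie_ideal_def
    by (rule algebra_ideal_hull) (rule lie_relators_subset, unfold_locales)
qed

lemma lie_algebra_free_lie:
  assumes "cring K"
  shows "lie_algebra K (free_lie K S)"
proof -
  define F where "F = free_nonassoc K S"
  define I where "I = free_lie_ideal K S"
  define L where "L = quotient_algebra F I"
  interpret algebra_quotient K F I
    unfolding F_def I_def
    by (intro algebra_quotient.intro nonassoc_algebra_free_nonassoc algebra_quotient_axioms.intro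
        free_lie_ideal_ideal assms)
  have rel: "I +>\<^bsub>F\<^esub> z = \<zero>\<^bsub>L\<^esub>" if "z \<in> lie_relators F" for z
    unfolding L_def
    by (rule proj_ideal) (use that in \<open>simp add: I_def F_def free_lie_ideal_def hull_inc\<close>)
  have square: "(I +>\<^bsub>F\<^esub> x) \<otimes>\<^bsub>L\<^esub> (I +>\<^bsub>F\<^esub> x) = \<zero>\<^bsub>L\<^esub>" if "x \<in> carrier F" for x
  proof -
    have "x \<otimes>\<^bsub>F\<^esub> x \<in> lie_relators F"
      using that by (auto simp: lie_relators_def)
    from rel[OF this] show ?thesis
      using that by (simp only: proj_mult L_def)
  qed
  have Jacobi: "(I +>\<^bsub>F\<^esub> x) \<otimes>\<^bsub>L\<^esub> ((I +>\<^bsub>F\<^esub> y) \<otimes>\<^bsub>L\<^esub> (I +>\<^bsub>F\<^esub> z)) \<oplus>\<^bsub>L\<^esub>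
      (I +>\<^bsub>F\<^esub> y) \<otimes>\<^bsub>L\<^esub> ((I +>\<^bsub>F\<^esub> z) \<otimes>\<^bsub>L\<^esub> (I +>\<^bsub>F\<^esub> x)) \<oplus>\<^bsub>L\<^esub>
      (I +>\<^bsub>F\<^esub> z) \<otimes>\<^bsub>L\<^esub> ((I +>\<^bsub>F\<^esub> x) \<otimes>\<^bsub>L\<^esub> (I +>\<^bsub>F\<^esub> y)) = \<zero>\<^bsub>L\<^esub>"
    if "x \<in> carrier F" "y \<in> carrier F" "z \<in> carrier F" for x y z
  proof -
    have "x \<otimes>\<^bsub>F\<^esub> (y \<otimes>\<^bsub>F\<^esub> z) \<oplus>\<^bsub>F\<^esub> y \<otimes>\<^bsub>F\<^esub> (z \<otimes>\<^bsub>F\<^esub> x) \<oplus>\<^bsub>F\<^esub> z \<otimes>\<^bsub>F\<^esub> (x \<otimes>\<^bsub>F\<^esub> y) \<in> lie_relators F"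
      using that by (auto simp: lie_relators_def)
    from rel[OF this] show ?thesis
      using that by (simp only: proj_mult proj_add L_def mult_closed M.a_closed)
  qed
  show ?thesis
    unfolding free_lie_def F_def[symmetric] I_def[symmetric] L_def[symmetric]
  proof (intro lie_algebra.intro lie_algebra_axioms.intro)
    show "nonassoc_algebra K L" unfolding L_def by (rule nonassoc_algebra_quotient)
  next
    fix x assume "x \<in> carrier L"
    then show "x \<otimes>\<^bsub>L\<^esub> x = \<zero>\<^bsub>L\<^esub>"
      unfolding L_def by (elim quotient_carrierE) (simp only: square[unfolded L_def])
  next
    fix x y z assume "x \<in> carrier L" "y \<in> carrier L" "z \<in> carrier L"
    then show "x \<otimes>\<^bsub>L\<^esub> (y \<otimes>\<^bsub>L\<^esub> z) \<oplus>\<^bsub>L\<^esub> y \<otimes>\<^bsub>L\<^esub> (z \<otimes>\<^bsub>L\<^esub> x) \<oplus>\<^bsub>L\<^esub> z \<otimes>\<^bsub>L\<^esub> (x \<otimes>\<^bsub>L\<^esub> y) = \<zero>\<^bsub>L\<^esub>"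
      unfolding L_def by (elim quotient_carrierE) (simp only: Jacobi[unfolded L_def])
  qed
qed

lemma free_lie_gen_closed:
  assumes "cring K" "x \<in> S"
  shows "free_lie_gen K S x \<in> carrier (free_lie K S)"
proof -
  interpret algebra_quotient K "free_nonassoc K S" "free_lie_ideal K S"
    by (intro algebra_quotient.intro nonassoc_algebra_free_nonassoc algebra_quotient_axioms.intro
        free_lie_ideal_ideal assms)
  interpret F: finsupp_module K "{t. set_magma_word t \<subseteq> S}" "free_nonassoc K S"
    by (rule finsupp_module_free_nonassoc) fact
  show ?thesis unfolding free_lie_gen_def free_lie_def
    using assms by (intro proj_closed F.basis_closed) auto
qed

text \<open>
  The universal property of the free Lie algebra.  The Lie subalgebra \<open>G\<close> keeps track of the image,
  which is needed to start the filtration argument.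
\<close>

lemma free_lie_lift:
  assumes N: "lie_algebra K N"
    and G: "submodule G K N" "\<And>x y. \<lbrakk>x \<in> G; y \<in> G\<rbrakk> \<Longrightarrow> x \<otimes>\<^bsub>N\<^esub> y \<in> G"
    and e: "\<And>x. x \<in> S \<Longrightarrow> e x \<in> G"
  obtains h where "algebra_map K (free_lie K S) N h"
    and "\<And>x. x \<in> S \<Longrightarrow> h (free_lie_gen K S x) = e x"
    and "h ` carrier (free_lie K S) \<subseteq> G"
proof -
  let ?F = "free_nonassoc K S" and ?h0 = "linear_extension K N (magma_eval N e)"
  interpret N: lie_algebra K N by fact
  have K: "cring K" by (rule N.R.cring_axioms)
  interpret F: nonassoc_algebra K ?F by (rule nonassoc_algebra_free_nonassoc) fact
  interpret FF: finsupp_module K "{t. set_magma_word t \<subseteq> S}" ?F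
    by (rule finsupp_module_free_nonassoc) fact
  have eN: "e x \<in> carrier N" if "x \<in> S" for x
    using e[OF that] N.submoduleE(1)[OF G(1)] by blast
  interpret h0: nonassoc_algebra_map K ?F N ?h0
    by unfold_locales (rule free_nonassoc_lift(1)[OF N.nonassoc_algebra_axioms eN])
  have "lie_relators ?F \<subseteq> {x \<in> carrier ?F. ?h0 x = \<zero>\<^bsub>N\<^esub>}"
    by (auto simp: lie_relators_def h0.mult h0.add N.alternating N.Jacobi)
  then have "free_lie_ideal K S \<subseteq> {x \<in> carrier ?F. ?h0 x = \<zero>\<^bsub>N\<^esub>}"
    unfolding free_lie_ideal_def by (intro hull_minimal h0.kernel_ideal)
  then interpret quotient_lift K ?F N ?h0 "free_lie_ideal K S"
    by unfold_locales (use free_lie_ideal_ideal[OF K] in auto)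
  have word: "magma_eval N e t \<in> G" if "set_magma_word t \<subseteq> S" for t
    using that by (induction t) (auto simp: e G)
  have basis: "?h0 (basis_elem K t) = magma_eval N e t" if "set_magma_word t \<subseteq> S" for t
  proof -
    interpret finsupp_extension K "{t. set_magma_word t \<subseteq> S}" ?F N "magma_eval N e"
      by unfold_locales (use eN in \<open>auto intro!: N.magma_eval_closed\<close>)
    show ?thesis using that by (simp add: linear_extension_basis)
  qed
  have in_G: "?h0 f \<in> G" if "f \<in> carrier ?F" for f
    using that
  proof (induction rule: FF.finsupp_induct)
    case zero
    then show ?case using subgroup.one_closed[OF submodule.axioms(1)[OF G(1)]] by simp
  qed (use N.submoduleE[OF G(1)] word basis in \<open>auto simp: h0.add h0.smult\<close>)
  show thesis
  proof
    show "algebra_map K (free_lie K S) N (\<lambda>Z. the_elem (?h0 ` Z))"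
      unfolding free_lie_def by (rule algebra_map_lift)
    show "the_elem (?h0 ` free_lie_gen K S x) = e x" if "x \<in> S" for x
      unfolding free_lie_gen_def using that by (simp add: lift_coset basis)
    show "(\<lambda>Z. the_elem (?h0 ` Z)) ` carrier (free_lie K S) \<subseteq> G"
      unfolding free_lie_def by (auto elim!: quotient_carrierE simp: lift_coset in_G)
  qed
qed

definition yang_mills_ideal :: "('k, 'm) ring_scheme \<Rightarrow> nat \<Rightarrow> (nat magma_word \<Rightarrow> 'k) set set"
  where "yang_mills_ideal K n =
    algebra_ideal K (free_lie K {1..n}) hull yang_mills_relators K n"

definition yang_mills_gen :: "('k, 'm) ring_scheme \<Rightarrow> nat \<Rightarrow> nat \<Rightarrow> (nat magma_word \<Rightarrow> 'k) set set"
  where "yang_mills_gen K n i =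
    yang_mills_ideal K n +>\<^bsub>free_lie K {1..n}\<^esub> free_lie_gen K {1..n} i"

lemma yang_mills_ideal_ideal:
  assumes "cring K"
  shows "algebra_ideal K (free_lie K {1..n}) (yang_mills_ideal K n)"
proof -
  note [simp del] = One_nat_def
  interpret lie_algebra K "free_lie K {1..n}" by (rule lie_algebra_free_lie) fact
  show ?thesis unfolding yang_mills_ideal_def
    by (rule algebra_ideal_hull)
      (auto simp: yang_mills_relators_def Let_def intro!: M.finsum_closed mult_closed free_lie_gen_closed[OF assms])
qed

lemma lie_algebra_yang_mills:
  assumes "cring K"
  shows "lie_algebra K (yang_mills K n)"
  unfolding yang_mills_def yang_mills_ideal_def[symmetric]
  by (rule lie_algebra.lie_algebra_quotient[OF lie_algebra_free_lie[OF assms] yang_mills_ideal_ideal[OF assms]])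

lemma yang_mills_gen_closed:
  assumes "cring K" "i \<in> {1..n}"
  shows "yang_mills_gen K n i \<in> carrier (yang_mills K n)"
proof -
  interpret lie_algebra K "free_lie K {1..n}" by (rule lie_algebra_free_lie) fact
  interpret algebra_quotient K "free_lie K {1..n}" "yang_mills_ideal K n"
    by unfold_locales (rule yang_mills_ideal_ideal[OF assms(1)])
  show ?thesis
    unfolding yang_mills_gen_def yang_mills_def yang_mills_ideal_def[symmetric]
    by (rule proj_closed) (rule free_lie_gen_closed[OF assms])
qed

lemma yang_mills_lift:
  assumes N: "lie_algebra K N"
    and G: "submodule G K N" "\<And>x y. \<lbrakk>x \<in> G; y \<in> G\<rbrakk> \<Longrightarrow> x \<otimes>\<^bsub>N\<^esub> y \<in> G"
    and e: "\<And>i. i \<in> {1..n} \<Longrightarrow> e i \<in> G"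
    and rel: "\<And>j. j \<in> {1..n} \<Longrightarrow> (\<Oplus>\<^bsub>N\<^esub>i\<in>{1..n}. e i \<otimes>\<^bsub>N\<^esub> (e i \<otimes>\<^bsub>N\<^esub> e j)) = \<zero>\<^bsub>N\<^esub>"
  obtains h where "algebra_map K (yang_mills K n) N h"
    and "\<And>i. i \<in> {1..n} \<Longrightarrow> h (yang_mills_gen K n i) = e i"
    and "h ` carrier (yang_mills K n) \<subseteq> G"
proof -
  note [simp del] = One_nat_def
  let ?F = "free_lie K {1..n}" and ?x = "free_lie_gen K {1..n}"
  interpret N: lie_algebra K N by fact
  have K: "cring K" by (rule N.R.cring_axioms)
  obtain h0 where h0: "algebra_map K ?F N h0" "\<And>i. i \<in> {1..n} \<Longrightarrow> h0 (?x i) = e i"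
      "h0 ` carrier ?F \<subseteq> G"
  proof (rule free_lie_lift[OF N G(1), of "{1..n}" e])
    show "x \<otimes>\<^bsub>N\<^esub> y \<in> G" if "x \<in> G" "y \<in> G" for x y using that by (rule G(2))
  qed (use e in \<open>simp_all only:\<close>)
  interpret F: lie_algebra K ?F by (rule lie_algebra_free_lie) fact
  interpret h0: nonassoc_algebra_map K ?F N h0 by unfold_locales (rule h0(1))
  note gen_closed = free_lie_gen_closed[OF K, of _ "{1..n}"]
  have eN: "e i \<in> carrier N" if "i \<in> {1..n}" for i
    using e[OF that] N.submoduleE(1)[OF G(1)] by blast
  have "h0 (\<Oplus>\<^bsub>?F\<^esub>i\<in>{1..n}. ?x i \<otimes>\<^bsub>?F\<^esub> (?x i \<otimes>\<^bsub>?F\<^esub> ?x j)) = \<zero>\<^bsub>N\<^esub>" if j: "j \<in> {1..n}" for j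
  proof -
    have "h0 (\<Oplus>\<^bsub>?F\<^esub>i\<in>{1..n}. ?x i \<otimes>\<^bsub>?F\<^esub> (?x i \<otimes>\<^bsub>?F\<^esub> ?x j)) =
        (\<Oplus>\<^bsub>N\<^esub>i\<in>{1..n}. h0 (?x i \<otimes>\<^bsub>?F\<^esub> (?x i \<otimes>\<^bsub>?F\<^esub> ?x j)))"
      by (intro h0.finsum Pi_I F.mult_closed gen_closed j finite_atLeastAtMost)
    also have "\<dots> = (\<Oplus>\<^bsub>N\<^esub>i\<in>{1..n}. e i \<otimes>\<^bsub>N\<^esub> (e i \<otimes>\<^bsub>N\<^esub> e j))"
    proof (rule N.M.finsum_cong'[OF refl])
      show "(\<lambda>i. e i \<otimes>\<^bsub>N\<^esub> (e i \<otimes>\<^bsub>N\<^esub> e j)) \<in> {1..n} \<rightarrow> carrier N"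
        by (intro Pi_I N.mult_closed eN j)
      show "h0 (?x i \<otimes>\<^bsub>?F\<^esub> (?x i \<otimes>\<^bsub>?F\<^esub> ?x j)) = e i \<otimes>\<^bsub>N\<^esub> (e i \<otimes>\<^bsub>N\<^esub> e j)"
        if i: "i \<in> {1..n}" for i
        by (simp only: h0.mult F.mult_closed gen_closed[OF i] gen_closed[OF j] h0(2)[OF i] h0(2)[OF j])
    qed
    also note rel[OF j]
    finally show ?thesis .
  qed
  moreover have "(\<Oplus>\<^bsub>?F\<^esub>i\<in>{1..n}. ?x i \<otimes>\<^bsub>?F\<^esub> (?x i \<otimes>\<^bsub>?F\<^esub> ?x j)) \<in> carrier ?F"
    if j: "j \<in> {1..n}" for j
    by (intro F.M.finsum_closed Pi_I F.mult_closed gen_closed j)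
  ultimately have "yang_mills_relators K n \<subseteq> {x \<in> carrier ?F. h0 x = \<zero>\<^bsub>N\<^esub>}"
    unfolding yang_mills_relators_def Let_def by blast
  then have "yang_mills_ideal K n \<subseteq> {x \<in> carrier ?F. h0 x = \<zero>\<^bsub>N\<^esub>}"
    unfolding yang_mills_ideal_def by (intro hull_minimal h0.kernel_ideal)
  then interpret quotient_lift K ?F N h0 "yang_mills_ideal K n"
    by unfold_locales (use yang_mills_ideal_ideal[OF K] in auto)
  show thesis
  proof
    show "algebra_map K (yang_mills K n) N (\<lambda>Z. the_elem (h0 ` Z))"
      unfolding yang_mills_def yang_mills_ideal_def[symmetric] by (rule algebra_map_lift)
    show "the_elem (h0 ` yang_mills_gen K n i) = e i" if "i \<in> {1..n}" for i
      unfolding yang_mills_gen_def using gen_closed[OF that] h0(2)[OF that] by (simp add: lift_coset)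
    show "(\<lambda>Z. the_elem (h0 ` Z)) ` carrier (yang_mills K n) \<subseteq> G"
      unfolding yang_mills_def yang_mills_ideal_def[symmetric]
      using h0(3) by (auto elim!: quotient_carrierE simp: lift_coset)
  qed
qed

section \<open>A solution of the Yang--Mills equations\<close>

lemma (in algebraically_closed) ex_sqrt_minus_one:
  obtains x where "x \<in> carrier L" "x \<otimes> x = \<ominus> \<one>"
proof -
  let ?f = "[\<one>, \<zero>, \<one>]"
  have f: "?f \<in> carrier (poly_ring L)"
    by (simp add: univ_poly_carrier[symmetric] polynomial_def)
  then have "size (roots ?f) = 2"
    using roots_over_carrier[OF f] by (simp add: splitted_def)
  then obtain x where "x \<in># roots ?f"
    by (metis size_eq_0_iff_empty multiset_nonemptyE zero_neq_numeral)
  then have x: "x \<in> carrier L" "eval ?f x = \<zero>"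
    using roots_mem_iff_is_root[OF f] by (auto simp: is_root_def)
  then have "x \<otimes> x \<oplus> \<one> = \<zero>"
    by (simp add: numeral_2_eq_2)
  then show thesis
    using that x minus_equality by (metis m_closed one_closed)
qed

text \<open>
  The operators of double bracketing with \<open>x\<close> and with \<open>\<iota>x\<close> are negatives of each other, which
  leaves the double bracket with \<open>a\<close>.  It kills \<open>a\<close>, and by assumption \<open>x\<close> and its multiples.
\<close>

lemma (in lie_algebra) yang_mills_solution:
  assumes a: "a \<in> carrier A" and x: "x \<in> carrier A"
    and aax: "a \<otimes>\<^bsub>A\<^esub> (a \<otimes>\<^bsub>A\<^esub> x) = \<zero>\<^bsub>A\<^esub>"
    and \<iota>: "\<iota> \<in> carrier K" "\<iota> \<otimes>\<^bsub>K\<^esub> \<iota> = \<ominus>\<^bsub>K\<^esub> \<one>\<^bsub>K\<^esub>"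
    and n: "n \<ge> 3"
  defines "e \<equiv> \<lambda>i::nat. if i = 1 then a else if i = 2 then x else if i = 3 then \<iota> \<odot>\<^bsub>A\<^esub> x else \<zero>\<^bsub>A\<^esub>"
  shows "(\<Oplus>\<^bsub>A\<^esub>i\<in>{1..n}. e i \<otimes>\<^bsub>A\<^esub> (e i \<otimes>\<^bsub>A\<^esub> e j)) = \<zero>\<^bsub>A\<^esub>"
proof -
  let ?t = "\<lambda>i. e i \<otimes>\<^bsub>A\<^esub> (e i \<otimes>\<^bsub>A\<^esub> e j)"
  have e: "e i \<in> carrier A" for i
    using a x \<iota> by (simp add: e_def)
  have e_zero: "e i = \<zero>\<^bsub>A\<^esub>" if "i \<in> {4..n}" for i
    using that by (simp add: e_def)
  have "{1..n} = insert 1 (insert 2 (insert 3 {4..n}))"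
    using n by auto
  then have "(\<Oplus>\<^bsub>A\<^esub>i\<in>{1..n}. ?t i) = ?t 1 \<oplus>\<^bsub>A\<^esub> (?t 2 \<oplus>\<^bsub>A\<^esub> (?t 3 \<oplus>\<^bsub>A\<^esub> (\<Oplus>\<^bsub>A\<^esub>i\<in>{4..n}. ?t i)))"
    using e by (simp add: M.finsum_insert Pi_iff)
  also have "(\<Oplus>\<^bsub>A\<^esub>i\<in>{4..n}. ?t i) = \<zero>\<^bsub>A\<^esub>"
    by (rule M.add.finprod_one_eqI) (simp add: e_zero e)
  also have "?t 1 = \<zero>\<^bsub>A\<^esub>"
    using a x \<iota> aax by (simp add: e_def alternating mult_smult_right)
  also have "?t 3 = (\<iota> \<otimes>\<^bsub>K\<^esub> \<iota>) \<odot>\<^bsub>A\<^esub> ?t 2"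
    using e[of j] x \<iota>(1) by (simp add: e_def mult_smult_left mult_smult_right smult_assoc1)
  also have "(\<iota> \<otimes>\<^bsub>K\<^esub> \<iota>) \<odot>\<^bsub>A\<^esub> ?t 2 = \<ominus>\<^bsub>A\<^esub> ?t 2"
    unfolding \<iota>(2) by (rule smult_neg_one) (use e in auto)
  finally show ?thesis using e by (simp add: M.r_neg)
qed

section \<open>A nilpotent Lie algebra that generates the Weyl algebra\<close>

text \<open>From here on brackets are computed by the derivation rule and not expanded into products.\<close>

declare commutator_algebra_simps(5) [simp del]

context assoc_algebra
begin

abbreviation bracket :: "'a \<Rightarrow> 'a \<Rightarrow> 'a"
  where "bracket x y \<equiv> x \<otimes>\<^bsub>commutator_algebra A\<^esub> y"

sublocale N: lie_algebra K "commutator_algebra A"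
  by (rule lie_algebra_commutator)

lemma bracket_closed [simp, intro]: "\<lbrakk>x \<in> carrier A; y \<in> carrier A\<rbrakk> \<Longrightarrow> bracket x y \<in> carrier A"
  using N.mult_closed[of x y] by simp

lemma bracket_self: "x \<in> carrier A \<Longrightarrow> bracket x x = \<zero>\<^bsub>A\<^esub>"
  using N.alternating[of x] by simp

lemma bracket_skew: "\<lbrakk>x \<in> carrier A; y \<in> carrier A\<rbrakk> \<Longrightarrow> bracket y x = \<ominus>\<^bsub>A\<^esub> bracket x y"
  using N.anticommutative[of x y] by simp

lemma bracket_zero [simp]:
  "x \<in> carrier A \<Longrightarrow> bracket x \<zero>\<^bsub>A\<^esub> = \<zero>\<^bsub>A\<^esub>" "x \<in> carrier A \<Longrightarrow> bracket \<zero>\<^bsub>A\<^esub> x = \<zero>\<^bsub>A\<^esub>"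
  using N.mult_zero_right[of x] N.mult_zero_left[of x] by simp_all

lemma bracket_one [simp]:
  "x \<in> carrier A \<Longrightarrow> bracket x \<one>\<^bsub>A\<^esub> = \<zero>\<^bsub>A\<^esub>" "x \<in> carrier A \<Longrightarrow> bracket \<one>\<^bsub>A\<^esub> x = \<zero>\<^bsub>A\<^esub>"
  by (simp_all add: commutator_algebra_simps(5) minus_self)

lemma bracket_add_left:
  "\<lbrakk>x \<in> carrier A; y \<in> carrier A; z \<in> carrier A\<rbrakk> \<Longrightarrow>
    bracket (x \<oplus>\<^bsub>A\<^esub> y) z = bracket x z \<oplus>\<^bsub>A\<^esub> bracket y z"
  using N.mult_add_left[of x y z] by simp

lemma bracket_mult_left:
  "\<lbrakk>x \<in> carrier A; y \<in> carrier A; z \<in> carrier A\<rbrakk> \<Longrightarrow>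
    bracket (x \<otimes>\<^bsub>A\<^esub> y) z = x \<otimes>\<^bsub>A\<^esub> bracket y z \<oplus>\<^bsub>A\<^esub> bracket x z \<otimes>\<^bsub>A\<^esub> y"
  unfolding commutator_algebra_simps(5) a_minus_def by algebra

lemma unital_subalgebra_bracket:
  assumes H: "unital_subalgebra K A H" and "x \<in> H" "y \<in> H"
  shows "bracket x y \<in> H"
  using assms submoduleE(3,5)[of H]
  by (auto simp: unital_subalgebra_def commutator_algebra_simps(5) a_minus_def)

end

text \<open>
  The computations are done in an arbitrary algebra with elements \<open>p i\<close> and \<open>q i\<close> that satisfy the
  canonical commutation relations.
\<close>

locale weyl_relations = assoc_algebra K A
  for K :: "('k, 'm) ring_scheme" and A :: "('k, 'a) module" +
  fixes r :: nat and p q :: "nat \<Rightarrow> 'a"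
  assumes r_pos: "r \<ge> 1"
    and p_closed: "i \<in> {1..r} \<Longrightarrow> p i \<in> carrier A"
    and q_closed: "i \<in> {1..r} \<Longrightarrow> q i \<in> carrier A"
    and bracket_pq: "\<lbrakk>i \<in> {1..r}; j \<in> {1..r}\<rbrakk> \<Longrightarrow> bracket (p i) (q j) = (if i = j then \<one>\<^bsub>A\<^esub> else \<zero>\<^bsub>A\<^esub>)"
    and bracket_pp: "\<lbrakk>i \<in> {1..r}; j \<in> {1..r}\<rbrakk> \<Longrightarrow> bracket (p i) (p j) = \<zero>\<^bsub>A\<^esub>"
    and bracket_qq: "\<lbrakk>i \<in> {1..r}; j \<in> {1..r}\<rbrakk> \<Longrightarrow> bracket (q i) (q j) = \<zero>\<^bsub>A\<^esub>"
begin

lemma bracket_qp: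
  "\<lbrakk>i \<in> {1..r}; j \<in> {1..r}\<rbrakk> \<Longrightarrow> bracket (q i) (p j) = (if i = j then \<ominus>\<^bsub>A\<^esub> \<one>\<^bsub>A\<^esub> else \<zero>\<^bsub>A\<^esub>)"
  using bracket_skew[of "p j" "q i"] bracket_pq[of j i] p_closed q_closed by auto

text \<open>
  \<open>quad k\<close> is \<open>p\<^sub>r\<^sup>2 + q\<^sub>2p\<^sub>1 + \<dots> + q\<^bsub>k+1\<^esub>p\<^sub>k\<close>, and \<open>shift\<close> is the element called \<open>x\<close> above.  For \<open>r = 1\<close>
  the quadratic element \<open>p\<^sub>1\<^sup>2\<close> would not do, as \<open>[q\<^sub>1, [q\<^sub>1, p\<^sub>1\<^sup>2]]\<close> is \<open>2\<close>.
\<close>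

primrec quad :: "nat \<Rightarrow> 'a"
  where "quad 0 = p r \<otimes>\<^bsub>A\<^esub> p r"
  | "quad (Suc k) = quad k \<oplus>\<^bsub>A\<^esub> q (k + 2) \<otimes>\<^bsub>A\<^esub> p (k + 1)"

definition shift :: 'a
  where "shift = (if r = 1 then p 1 else quad (r - 1))"

lemma quad_closed: "k < r \<Longrightarrow> quad k \<in> carrier A"
  using r_pos by (induction k) (auto simp: p_closed q_closed)

lemma shift_closed: "shift \<in> carrier A"
  using r_pos by (auto simp: shift_def p_closed quad_closed)

lemma bracket_quad_q:
  assumes "k < r" "j \<in> {1..r}"
  shows "bracket (quad k) (q j) =
    (if j \<le> k then q (j + 1) else if j = r then p r \<oplus>\<^bsub>A\<^esub> p r else \<zero>\<^bsub>A\<^esub>)"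
  using assms
proof (induction k)
  case 0
  then show ?case
    by (simp add: bracket_mult_left p_closed q_closed bracket_pq)
next
  case (Suc k)
  then have "bracket (q (k + 2) \<otimes>\<^bsub>A\<^esub> p (k + 1)) (q j) = (if j = k + 1 then q (j + 1) else \<zero>\<^bsub>A\<^esub>)"
    by (simp add: bracket_mult_left p_closed q_closed bracket_pq bracket_qq)
  then show ?case
    using Suc by (auto simp: bracket_add_left quad_closed p_closed q_closed)
qed

lemma bracket_quad_p:
  assumes "k < r" "j \<in> {1..r}"
  shows "bracket (quad k) (p j) = (if 2 \<le> j \<and> j \<le> k + 1 then \<ominus>\<^bsub>A\<^esub> p (j - 1) else \<zero>\<^bsub>A\<^esub>)"
  using assms
proof (induction k)
  case 0
  then show ?case
    by (auto simp: bracket_mult_left p_closed bracket_pp)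
next
  case (Suc k)
  then have "bracket (q (k + 2) \<otimes>\<^bsub>A\<^esub> p (k + 1)) (p j) = (if j = k + 2 then \<ominus>\<^bsub>A\<^esub> p (j - 1) else \<zero>\<^bsub>A\<^esub>)"
    by (simp add: bracket_mult_left p_closed q_closed bracket_pp bracket_qp A.l_minus)
  moreover have "p (j - 1) \<in> carrier A" if "2 \<le> j"
    using that Suc.prems by (intro p_closed) auto
  ultimately show ?case
    using Suc by (auto simp: bracket_add_left quad_closed p_closed q_closed)
qed

lemma bracket_shift_q:
  "\<lbrakk>1 \<le> j; j < r\<rbrakk> \<Longrightarrow> bracket shift (q j) = q (j + 1)"
  "r \<noteq> 1 \<Longrightarrow> bracket shift (q r) = p r \<oplus>\<^bsub>A\<^esub> p r"
  using r_pos by (auto simp: shift_def bracket_quad_q)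

lemma bracket_shift_p:
  "\<lbrakk>2 \<le> j; j \<le> r\<rbrakk> \<Longrightarrow> bracket shift (p j) = \<ominus>\<^bsub>A\<^esub> p (j - 1)"
  "bracket shift (p 1) = \<zero>\<^bsub>A\<^esub>"
  using r_pos by (auto simp: shift_def bracket_quad_p bracket_pp)

text \<open>The assumption of \<open>yang_mills_solution\<close>, because \<open>[q\<^sub>1, x]\<close> is \<open>-q\<^sub>2\<close> or, for \<open>r = 1\<close>, \<open>-1\<close>.\<close>

lemma bracket_q_q_shift: "bracket (q 1) (bracket (q 1) shift) = \<zero>\<^bsub>A\<^esub>"
proof (cases "r = 1")
  case True
  then have "bracket (q 1) shift = \<ominus>\<^bsub>A\<^esub> \<one>\<^bsub>A\<^esub>"
    unfolding shift_def using bracket_qp[of 1 1] by simp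
  then show ?thesis
    using r_pos q_closed[of 1] N.mult_smult_right[of "\<ominus>\<^bsub>K\<^esub> \<one>\<^bsub>K\<^esub>" "q 1" "\<one>\<^bsub>A\<^esub>"]
    by (simp add: smult_neg_one)
next
  case False
  then have "bracket (q 1) shift = \<ominus>\<^bsub>A\<^esub> q 2"
    using r_pos bracket_skew[of shift "q 1"] bracket_shift_q(1)[of 1]
    by (simp add: shift_closed q_closed numeral_2_eq_2)
  then show ?thesis
    using False r_pos q_closed[of 1] q_closed[of 2] bracket_qq[of 1 2]
      N.mult_smult_right[of "\<ominus>\<^bsub>K\<^esub> \<one>\<^bsub>K\<^esub>" "q 1" "q 2"]
    by (simp add: smult_neg_one)
qed

text \<open>The sequence \<open>x, q\<^sub>1, \<dots>, q\<^sub>r, p\<^sub>r, \<dots>, p\<^sub>1, 1, 0, 0, \<dots>\<close>.\<close>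

definition chain :: "nat \<Rightarrow> 'a"
  where "chain k = (if k = 0 then shift else if k \<le> r then q k
    else if k \<le> 2 * r then p (2 * r + 1 - k) else if k = 2 * r + 1 then \<one>\<^bsub>A\<^esub> else \<zero>\<^bsub>A\<^esub>)"

lemma chain_closed: "chain k \<in> carrier A"
proof -
  consider "k = 0" | "1 \<le> k" "k \<le> r" | "r < k" "2 * r + 1 - k \<in> {1..r}" "k \<le> 2 * r" | "k > 2 * r"
    by fastforce
  then show ?thesis
    by cases (auto simp: chain_def shift_closed p_closed q_closed)
qed

lemma chain_zero: "k > 2 * r + 1 \<Longrightarrow> chain k = \<zero>\<^bsub>A\<^esub>"
  by (simp add: chain_def)

lemma bracket_shift_chain:
  assumes "k \<ge> 1"
  shows "\<exists>c\<in>carrier K. \<exists>j>k. bracket shift (chain k) = c \<odot>\<^bsub>A\<^esub> chain j"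
proof -
  have zero: ?thesis if "bracket shift (chain k) = \<zero>\<^bsub>A\<^esub>"
    using that by (intro bexI[of _ "\<zero>\<^bsub>K\<^esub>"] exI[of _ "k + 1"]) (auto simp: chain_closed)
  have one: ?thesis if "bracket shift (chain k) = chain j" "j > k" for j
    using that by (intro bexI[of _ "\<one>\<^bsub>K\<^esub>"] exI[of _ j]) (auto simp: chain_closed)
  consider "k < r" | "k = r" "r = 1" | "k = r" "r \<noteq> 1" | "r < k" "k < 2 * r" | "k = 2 * r" "r < k" | "k > 2 * r"
    using assms by linarith
  then show ?thesis
  proof cases
    case 1
    then show ?thesis
      using assms one[of "k + 1"] by (simp add: chain_def bracket_shift_q)
  next
    case 2
    have "bracket shift (chain k) = bracket (p 1) (q 1)"
      unfolding shift_def chain_def using 2 by simp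
    also have "\<dots> = \<one>\<^bsub>A\<^esub>" using r_pos bracket_pq[of 1 1] by simp
    also have "\<dots> = chain 3" unfolding chain_def using 2 by simp
    finally show ?thesis by (rule one) (use 2 in simp)
  next
    case 3
    have "bracket shift (chain k) = (\<one>\<^bsub>K\<^esub> \<oplus>\<^bsub>K\<^esub> \<one>\<^bsub>K\<^esub>) \<odot>\<^bsub>A\<^esub> chain (k + 1)"
      using 3 r_pos by (simp add: chain_def bracket_shift_q p_closed smult_l_distr)
    then show ?thesis
      by (intro bexI[of _ "\<one>\<^bsub>K\<^esub> \<oplus>\<^bsub>K\<^esub> \<one>\<^bsub>K\<^esub>"] exI[of _ "k + 1"]) auto
  next
    case 4
    have "2 \<le> 2 * r + 1 - k" "2 * r + 1 - k \<le> r" using 4 by auto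
    moreover have "p (2 * r - k) \<in> carrier A" using 4 by (intro p_closed) auto
    ultimately have "bracket shift (chain k) = (\<ominus>\<^bsub>K\<^esub> \<one>\<^bsub>K\<^esub>) \<odot>\<^bsub>A\<^esub> chain (k + 1)"
      using 4 bracket_shift_p(1)[of "2 * r + 1 - k"]
      by (simp add: chain_def smult_neg_one)
    then show ?thesis
      by (intro bexI[of _ "\<ominus>\<^bsub>K\<^esub> \<one>\<^bsub>K\<^esub>"] exI[of _ "k + 1"]) auto
  next
    case 5
    then show ?thesis
      by (intro zero) (simp add: chain_def bracket_shift_p(2)[simplified])
  next
    case 6
    then show ?thesis
      by (intro zero) (simp add: chain_def shift_closed)
  qed
qed

text \<open>
  Brackets of two \<open>p\<close>'s or \<open>q\<close>'s are multiples of \<open>1\<close>, which stands behind all of them in the chain;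
  brackets that involve \<open>1\<close> or \<open>0\<close> vanish.
\<close>

lemma bracket_chain_central:
  assumes "i \<ge> 1" "k \<ge> 1"
  shows "\<exists>c\<in>carrier K. \<exists>j>max i k. bracket (chain i) (chain k) = c \<odot>\<^bsub>A\<^esub> chain j"
proof -
  have zero: ?thesis if "bracket (chain i) (chain k) = \<zero>\<^bsub>A\<^esub>"
    using that by (intro bexI[of _ "\<zero>\<^bsub>K\<^esub>"] exI[of _ "max i k + 1"]) (auto simp: chain_closed)
  show ?thesis
  proof (cases "i \<le> 2 * r \<and> k \<le> 2 * r")
    case True
    have "chain l \<in> q ` {1..r} \<union> p ` {1..r}" if "1 \<le> l" "l \<le> 2 * r" for l
    proof (cases "l \<le> r")
      case False
      then have "2 * r + 1 - l \<in> {1..r}" using that by auto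
      then show ?thesis using False that by (simp add: chain_def)
    qed (use that in \<open>simp add: chain_def\<close>)
    then have "chain i \<in> q ` {1..r} \<union> p ` {1..r}" "chain k \<in> q ` {1..r} \<union> p ` {1..r}"
      using True assms by auto
    then have "bracket (chain i) (chain k) \<in> {\<zero>\<^bsub>A\<^esub>, \<one>\<^bsub>A\<^esub>, \<ominus>\<^bsub>A\<^esub> \<one>\<^bsub>A\<^esub>}"
      by (elim UnE imageE) (simp_all add: bracket_pp bracket_qq bracket_pq bracket_qp)
    then have "\<exists>c\<in>carrier K. bracket (chain i) (chain k) = c \<odot>\<^bsub>A\<^esub> \<one>\<^bsub>A\<^esub>"
      using smult_neg_one[of "\<one>\<^bsub>A\<^esub>"]
      by (auto intro: bexI[of _ "\<zero>\<^bsub>K\<^esub>"] bexI[of _ "\<one>\<^bsub>K\<^esub>"] bexI[of _ "\<ominus>\<^bsub>K\<^esub> \<one>\<^bsub>K\<^esub>"])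
    moreover have "chain (2 * r + 1) = \<one>\<^bsub>A\<^esub>" by (simp add: chain_def)
    ultimately show ?thesis using True by (metis le_imp_less_Suc max.bounded_iff Suc_eq_plus1)
  next
    case False
    then have "chain i = \<one>\<^bsub>A\<^esub> \<or> chain i = \<zero>\<^bsub>A\<^esub> \<or> chain k = \<one>\<^bsub>A\<^esub> \<or> chain k = \<zero>\<^bsub>A\<^esub>"
      using assms by (auto simp: chain_def)
    then show ?thesis
      using zero chain_closed by fastforce
  qed
qed

lemma chain_triangular:
  "\<exists>c\<in>carrier K. \<exists>j>max i k. bracket (chain i) (chain k) = c \<odot>\<^bsub>A\<^esub> chain j"
proof -
  have chain_0: "chain 0 = shift" by (simp add: chain_def)
  consider "i = 0" "k = 0" | "i = 0" "k \<ge> 1" | "i \<ge> 1" "k = 0" | "i \<ge> 1" "k \<ge> 1" by linarith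
  then show ?thesis
  proof cases
    case 1
    then have "bracket (chain i) (chain k) = \<zero>\<^bsub>K\<^esub> \<odot>\<^bsub>A\<^esub> chain 1"
      by (simp add: bracket_self chain_closed)
    then show ?thesis using 1 by (intro bexI[of _ "\<zero>\<^bsub>K\<^esub>"] exI[of _ 1]) auto
  next
    case 2
    then show ?thesis using bracket_shift_chain[of k] chain_0 by simp
  next
    case 3
    then obtain c j where "c \<in> carrier K" "j > i" "bracket shift (chain i) = c \<odot>\<^bsub>A\<^esub> chain j"
      using bracket_shift_chain by blast
    then show ?thesis
      using 3 bracket_skew[of shift "chain i"] chain_0
      by (intro bexI[of _ "\<ominus>\<^bsub>K\<^esub> c"] exI[of _ j]) (auto simp: smult_l_minus chain_closed shift_closed)
  next
    case 4
    then show ?thesis by (rule bracket_chain_central)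
  qed
qed

text \<open>
  A subalgebra with \<open>q\<^sub>1\<close> and \<open>x\<close> contains the whole chain, one bracket with \<open>x\<close> after the other.
  The step from \<open>q\<^sub>r\<close> yields \<open>2p\<^sub>r\<close>; this is where the characteristic matters.
\<close>

lemma weyl_generators_mem:
  assumes K: "field K" and two: "\<one>\<^bsub>K\<^esub> \<oplus>\<^bsub>K\<^esub> \<one>\<^bsub>K\<^esub> \<noteq> \<zero>\<^bsub>K\<^esub>"
    and H: "unital_subalgebra K A H" and q1: "q 1 \<in> H" and sh: "shift \<in> H" and i: "i \<in> {1..r}"
  shows "q i \<in> H" "p i \<in> H"
proof -
  interpret K: field K by fact
  note br = unital_subalgebra_bracket[OF H]
  have sub: "submodule H K A" using H by (simp add: unital_subalgebra_def)
  have q: "1 \<le> j \<Longrightarrow> j \<le> r \<Longrightarrow> q j \<in> H" for j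
  proof (induction j)
    case (Suc j)
    then show ?case
      using q1 br[OF sh, of "q j"] bracket_shift_q(1)[of j] by (cases "j = 0") auto
  qed simp
  then show "q i \<in> H" using i by simp
  have "p r \<in> H"
  proof (cases "r = 1")
    case True
    then have "shift = p r" unfolding shift_def by simp
    then show ?thesis using sh by simp
  next
    case False
    let ?c = "inv\<^bsub>K\<^esub> (\<one>\<^bsub>K\<^esub> \<oplus>\<^bsub>K\<^esub> \<one>\<^bsub>K\<^esub>)"
    have c: "?c \<in> carrier K" "?c \<otimes>\<^bsub>K\<^esub> (\<one>\<^bsub>K\<^esub> \<oplus>\<^bsub>K\<^esub> \<one>\<^bsub>K\<^esub>) = \<one>\<^bsub>K\<^esub>"
      using two K.field_Units by auto
    have "p r \<oplus>\<^bsub>A\<^esub> p r \<in> H"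
      using br[OF sh q[of r]] bracket_shift_q(2)[OF False] r_pos by simp
    then have "?c \<odot>\<^bsub>A\<^esub> (p r \<oplus>\<^bsub>A\<^esub> p r) \<in> H"
      using c submoduleE(4)[OF sub] by blast
    moreover have "?c \<odot>\<^bsub>A\<^esub> (p r \<oplus>\<^bsub>A\<^esub> p r) = (?c \<otimes>\<^bsub>K\<^esub> (\<one>\<^bsub>K\<^esub> \<oplus>\<^bsub>K\<^esub> \<one>\<^bsub>K\<^esub>)) \<odot>\<^bsub>A\<^esub> p r"
      using c(1) p_closed[of r] r_pos
        smult_assoc1[of ?c "\<one>\<^bsub>K\<^esub> \<oplus>\<^bsub>K\<^esub> \<one>\<^bsub>K\<^esub>" "p r"] smult_l_distr[of "\<one>\<^bsub>K\<^esub>" "\<one>\<^bsub>K\<^esub>" "p r"] by simp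
    ultimately show ?thesis using c p_closed[of r] r_pos by simp
  qed
  \<comment> \<open>The chain runs through the \<open>p\<close>'s downwards, from \<open>p\<^sub>r\<close> to \<open>p\<^sub>1\<close>.\<close>
  have "j < r \<Longrightarrow> p (r - j) \<in> H" for j
  proof (induction j)
    case (Suc j)
    then have "bracket shift (p (r - j)) \<in> H"
      by (intro br[OF sh]) simp
    then have "\<ominus>\<^bsub>A\<^esub> p (r - Suc j) \<in> H"
      using bracket_shift_p(1)[of "r - j"] Suc.prems by (simp add: Suc_diff_Suc)
    then show ?case
      using submoduleE(3)[OF sub, of "\<ominus>\<^bsub>A\<^esub> p (r - Suc j)"] Suc.prems by (simp add: p_closed)
  qed (use \<open>p r \<in> H\<close> in simp)
  from this[of "r - i"] show "p i \<in> H" using i by auto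
qed

end


section \<open>The homomorphisms onto the Weyl algebra\<close>

text \<open>
  Both parts hold by construction: the relators lie in the ideal that is divided out, and the
  generators of the free algebra generate its quotient.
\<close>

lemma weyl_algebra_relations_and_generators:
  fixes r :: nat
  assumes K: "cring K" and r: "r \<ge> 1"
  defines "J \<equiv> Idl\<^bsub>free_algebra K (weyl_gens r)\<^esub> (weyl_relators K r)"
  defines "\<pi> \<equiv> \<lambda>g. J +>\<^bsub>free_algebra K (weyl_gens r)\<^esub> basis_elem K [g]"
  shows "weyl_relations K (weyl_algebra K r) r (\<lambda>i. \<pi> (P i)) (\<lambda>i. \<pi> (Q i))"
    and "\<lbrakk>unital_subalgebra K (weyl_algebra K r) H;
          \<And>i. i \<in> {1..r} \<Longrightarrow> \<pi> (P i) \<in> H \<and> \<pi> (Q i) \<in> H\<rbrakk> \<Longrightarrow> H = carrier (weyl_algebra K r)"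
proof -
  define T where "T = free_algebra K (weyl_gens r)"
  define A where "A = weyl_algebra K r"
  interpret T: assoc_algebra K T
    unfolding T_def by (rule assoc_algebra_free_algebra[OF K])
  interpret F: finsupp_module K "lists (weyl_gens r)" T
    unfolding T_def by (rule finsupp_module_free_algebra[OF K])
  have gens: "basis_elem K [P i] \<in> carrier T" "basis_elem K [Q i] \<in> carrier T" if "i \<in> {1..r}" for i
    using that by (auto simp: weyl_gens_def intro!: F.basis_closed)
  have rel_closed: "weyl_relators K r \<subseteq> carrier T"
    unfolding weyl_relators_def Let_def T_def[symmetric]
    by (auto intro!: T.M.minus_closed T.mult_closed gens)
  have rel_J: "weyl_relators K r \<subseteq> J"
    unfolding J_def T_def[symmetric] by (rule T.A.genideal_self[OF rel_closed])
  have J: "algebra_ideal K T J"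
    unfolding J_def T_def[symmetric]
    by (rule T.ideal_imp_algebra_ideal[OF T.A.genideal_ideal[OF rel_closed]])
  have A_eq: "A = quotient_algebra T J"
    by (simp add: A_def weyl_algebra_def J_def T_def)
  have A: "assoc_algebra K A"
    unfolding A_eq by (rule assoc_algebra_quotient[OF T.assoc_algebra_axioms J])
  interpret A: assoc_algebra K A by (rule A)
  interpret J: algebra_quotient K T J by unfold_locales (rule J)
  interpret pr: nonassoc_algebra_map K T A "\<lambda>t. J +>\<^bsub>T\<^esub> t"
    by unfold_locales (unfold A_eq, rule J.algebra_map_proj)
  have \<pi>: "\<pi> g = J +>\<^bsub>T\<^esub> basis_elem K [g]" for g
    by (simp add: \<pi>_def T_def)
  have pr_one: "J +>\<^bsub>T\<^esub> \<one>\<^bsub>T\<^esub> = \<one>\<^bsub>A\<^esub>" unfolding A_eq by (rule J.proj_one)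
  define comm where "comm x y = x \<otimes>\<^bsub>T\<^esub> y \<ominus>\<^bsub>T\<^esub> y \<otimes>\<^bsub>T\<^esub> x" for x y
  have comm_closed: "comm x y \<in> carrier T" if "x \<in> carrier T" "y \<in> carrier T" for x y
    using that by (simp add: comm_def T.M.minus_closed)
  have pr_comm: "J +>\<^bsub>T\<^esub> comm x y = A.bracket (J +>\<^bsub>T\<^esub> x) (J +>\<^bsub>T\<^esub> y)"
    if "x \<in> carrier T" "y \<in> carrier T" for x y
    using that by (simp add: comm_def pr.minus pr.mult commutator_algebra_simps(5))
  have rels: "comm (basis_elem K [P i]) (basis_elem K [Q j]) \<ominus>\<^bsub>T\<^esub> (if i = j then \<one>\<^bsub>T\<^esub> else \<zero>\<^bsub>T\<^esub>) \<in> J"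
    "comm (basis_elem K [P i]) (basis_elem K [P j]) \<in> J"
    "comm (basis_elem K [Q i]) (basis_elem K [Q j]) \<in> J" if "i \<in> {1..r}" "j \<in> {1..r}" for i j
    using that rel_J unfolding weyl_relators_def Let_def T_def[symmetric] comm_def by blast+
  show "weyl_relations K (weyl_algebra K r) r (\<lambda>i. \<pi> (P i)) (\<lambda>i. \<pi> (Q i))"
    unfolding A_def[symmetric]
  proof (unfold_locales)
    show "r \<ge> 1" by (rule r)
    fix i assume i: "i \<in> {1..r}"
    show "\<pi> (P i) \<in> carrier A" "\<pi> (Q i) \<in> carrier A"
      unfolding \<pi> using gens[OF i] by auto
    fix j assume j: "j \<in> {1..r}"
    show "A.bracket (\<pi> (P i)) (\<pi> (P j)) = \<zero>\<^bsub>A\<^esub>" "A.bracket (\<pi> (Q i)) (\<pi> (Q j)) = \<zero>\<^bsub>A\<^esub>"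
      unfolding \<pi> using J.proj_ideal[OF rels(2)[OF i j]] J.proj_ideal[OF rels(3)[OF i j]] gens[OF i] gens[OF j]
      by (simp_all add: pr_comm A_eq)
    have "J +>\<^bsub>T\<^esub> comm (basis_elem K [P i]) (basis_elem K [Q j]) = J +>\<^bsub>T\<^esub> (if i = j then \<one>\<^bsub>T\<^esub> else \<zero>\<^bsub>T\<^esub>)"
      by (rule J.coset_eq_if_minus[OF _ _ rels(1)[OF i j]]) (auto intro!: comm_closed gens i j)
    then show "A.bracket (\<pi> (P i)) (\<pi> (Q j)) = (if i = j then \<one>\<^bsub>A\<^esub> else \<zero>\<^bsub>A\<^esub>)"
      unfolding \<pi> using gens[OF i] gens[OF j] pr_one pr.zero by (simp add: pr_comm split: if_splits)
  qed
  show "H = carrier (weyl_algebra K r)"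
    if H: "unital_subalgebra K (weyl_algebra K r) H"
      and mem: "\<And>i. i \<in> {1..r} \<Longrightarrow> \<pi> (P i) \<in> H \<and> \<pi> (Q i) \<in> H"
  proof -
    have "J +>\<^bsub>T\<^esub> basis_elem K [g] \<in> H" if "g \<in> weyl_gens r" for g
      using that mem unfolding weyl_gens_def \<pi> by blast
    then show ?thesis
      using free_algebra_quotient_generated[OF K, of "weyl_gens r" J H, folded T_def, OF J]
        H[folded A_def] unfolding A_def[symmetric] A_eq by blast
  qed
qed

theorem corollary4p5:
  fixes K :: "('k, 'm) ring_scheme" and r n :: nat
  assumes alg_closed: "algebraically_closed K"
    and char_zero: "\<And>m::nat. m > 0 \<Longrightarrow> [m] \<cdot>\<^bsub>K\<^esub> \<one>\<^bsub>K\<^esub> \<noteq> \<zero>\<^bsub>K\<^esub>"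
    and r: "r \<ge> 1" and n: "n \<ge> 3"
  shows "let \<YY> = yang_mills K n; U = enveloping K \<YY>; A = weyl_algebra K r in
    (\<exists>\<phi>. \<phi> \<in> algebra_hom K U A \<and> \<phi> ` carrier U = carrier A) \<and>
    (\<exists>l\<ge>1. let C = lower_central K \<YY> l; V = enveloping K (quotient_algebra \<YY> C) in
      \<exists>\<phi> \<psi>. \<phi> \<in> algebra_hom K U A \<and> \<phi> ` carrier U = carrier A \<and>
            \<psi> \<in> algebra_hom K V A \<and> \<psi> ` carrier V = carrier A \<and>
            (\<forall>u\<in>carrier U. \<phi> u = \<psi> (enveloping_proj K \<YY> C u)))"
proof -
  interpret K: algebraically_closed K by (rule alg_closed)
  have cring: "cring K" by (rule K.cring_axioms)
  have two: "\<one>\<^bsub>K\<^esub> \<oplus>\<^bsub>K\<^esub> \<one>\<^bsub>K\<^esub> \<noteq> \<zero>\<^bsub>K\<^esub>"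
    using char_zero[of 2] by (simp add: numeral_2_eq_2)
  obtain \<iota> where \<iota>: "\<iota> \<in> carrier K" "\<iota> \<otimes>\<^bsub>K\<^esub> \<iota> = \<ominus>\<^bsub>K\<^esub> \<one>\<^bsub>K\<^esub>"
    by (rule K.ex_sqrt_minus_one)
  define A where "A = weyl_algebra K r"
  define Y where "Y = yang_mills K n"
  define U where "U = enveloping K Y"
  obtain p q where W: "weyl_relations K A r p q"
    and generated: "\<And>H. \<lbrakk>unital_subalgebra K A H; \<And>i. i \<in> {1..r} \<Longrightarrow> p i \<in> H \<and> q i \<in> H\<rbrakk> \<Longrightarrow> H = carrier A"
    using weyl_algebra_relations_and_generators[OF cring r] unfolding A_def by blast
  interpret W: weyl_relations K A r p q by (rule W)
  define G where "G m = (\<lambda>H. submodule H K (commutator_algebra A)) hull {W.chain j | j. m \<le> j}" for m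
  have chain_N: "W.chain j \<in> carrier (commutator_algebra A)" for j
    using W.chain_closed by simp
  have tri: "\<exists>c\<in>carrier K. \<exists>j>max i k. W.bracket (W.chain i) (W.chain k) =
      c \<odot>\<^bsub>commutator_algebra A\<^esub> W.chain j" for i k
    using W.chain_triangular by simp
  note filtration = W.N.triangular_filtration[of W.chain, OF chain_N tri, folded G_def]
  \<comment> \<open>The images of the generators of the Yang--Mills algebra.\<close>
  define e where "e i = (if i = 1 then q 1 else if i = 2 then W.shift
    else if i = 3 then \<iota> \<odot>\<^bsub>A\<^esub> W.shift else \<zero>\<^bsub>A\<^esub>)" for i :: nat
  have q1: "q 1 \<in> carrier A" using r by (intro W.q_closed) simp
  have chain_G: "W.chain j \<in> G 0" for j
    unfolding G_def by (rule hull_inc) auto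
  have e_G: "e i \<in> G 0" for i
  proof -
    have "q 1 \<in> G 0" "W.shift \<in> G 0"
      using chain_G[of 1] chain_G[of 0] r by (simp_all add: W.chain_def)
    then show ?thesis
      using W.N.submoduleE(4)[OF filtration(1)] \<iota>(1)
        subgroup.one_closed[OF submodule.axioms(1)[OF filtration(1)]]
      by (auto simp: e_def)
  qed
  have relations: "(\<Oplus>\<^bsub>commutator_algebra A\<^esub>i\<in>{1..n}. W.bracket (e i) (W.bracket (e i) (e j)))
      = \<zero>\<^bsub>commutator_algebra A\<^esub>" for j
    using W.N.yang_mills_solution[of "q 1" W.shift \<iota> n j] q1 W.shift_closed W.bracket_q_q_shift \<iota> n
    by (simp only: commutator_algebra_simps(1-4) e_def[abs_def])
  have dec: "G 1 \<subseteq> G 0"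
    unfolding G_def by (rule hull_mono) auto
  have G_mult: "W.bracket x y \<in> G 0" if "x \<in> G 0" "y \<in> G 0" for x y
    using filtration(2)[OF that] dec by auto
  obtain h where h: "algebra_map K Y (commutator_algebra A) h"
    and h_gen: "\<And>i. i \<in> {1..n} \<Longrightarrow> h (yang_mills_gen K n i) = e i"
    and h_G: "h ` carrier Y \<subseteq> G 0"
  proof (rule yang_mills_lift[OF W.N.lie_algebra_axioms filtration(1) _ e_G relations, folded Y_def])
    show "W.bracket x y \<in> G 0" if "x \<in> G 0" "y \<in> G 0" for x y
      using that by (rule G_mult)
    fix h
    assume "algebra_map K Y (commutator_algebra A) h"
      "\<And>i. i \<in> {1..n} \<Longrightarrow> h (yang_mills_gen K n i) = e i"
      "h ` carrier Y \<subseteq> G 0"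
    then show thesis by (rule that)
  qed
  interpret Y: lie_algebra K Y
    unfolding Y_def by (rule lie_algebra_yang_mills[OF cring])
  interpret h: nonassoc_algebra_map K Y "commutator_algebra A" h
    by unfold_locales (rule h)
  interpret E: enveloping_target K Y A h
    by unfold_locales (rule h)
  \<comment> \<open>The first index from which on the chain vanishes.\<close>
  let ?l = "2 * r + 2"
  define C where "C = lower_central K Y ?l"
  define V where "V = enveloping K (quotient_algebra Y C)"
  have h_C: "h x = \<zero>\<^bsub>A\<^esub>" if "x \<in> C" for x
  proof -
    have "h ` C \<subseteq> G ?l"
      unfolding C_def by (rule h.lower_central_image[of G, OF filtration(1) h_G filtration(2)])
    moreover have "G ?l = {\<zero>\<^bsub>A\<^esub>}"
      using filtration(3)[of ?l] W.chain_zero by simp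
    ultimately show ?thesis using that by auto
  qed
  have C: "algebra_ideal K Y C"
    unfolding C_def by (rule Y.lower_central_ideal)
  define \<phi> where "\<phi> = enveloping_lift K A h"
  have \<phi>: "\<phi> \<in> algebra_hom K U A"
    unfolding \<phi>_def U_def by (rule E.enveloping_lift_hom)
  have image: "unital_subalgebra K A (\<phi> ` carrier U)"
    by (rule unital_subalgebra_image[OF _ W.assoc_algebra_axioms \<phi>])
      (unfold U_def, rule E.assoc_algebra_enveloping)
  have "e i \<in> \<phi> ` carrier U" if i: "i \<in> {1..n}" for i
  proof -
    have y: "yang_mills_gen K n i \<in> carrier Y"
      unfolding Y_def by (rule yang_mills_gen_closed[OF cring i])
    have "\<phi> (enveloping_incl K Y (yang_mills_gen K n i)) = e i"
      unfolding \<phi>_def using E.enveloping_lift_incl[OF y] h_gen[OF i] by simp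
    then show ?thesis
      unfolding U_def using E.enveloping_incl_closed[OF y] by (metis imageI)
  qed
  from this[of 1] this[of 2] have "q 1 \<in> \<phi> ` carrier U" "W.shift \<in> \<phi> ` carrier U"
    using n by (auto simp: e_def)
  then have \<phi>_surj: "\<phi> ` carrier U = carrier A"
    using W.weyl_generators_mem[OF K.field_axioms two image] by (intro generated[OF image]) auto
  obtain \<psi> where \<psi>: "\<psi> \<in> algebra_hom K V A"
    and factor: "\<And>u. u \<in> carrier U \<Longrightarrow> \<phi> u = \<psi> (enveloping_proj K Y C u)"
    and proj: "\<And>u. u \<in> carrier U \<Longrightarrow> enveloping_proj K Y C u \<in> carrier V"
  proof (rule enveloping_lift_quotient[OF Y.nonassoc_algebra_axioms W.assoc_algebra_axioms h C h_C,
        folded U_def V_def \<phi>_def])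
    fix \<psi>
    assume "\<psi> \<in> algebra_hom K V A"
      "\<And>u. u \<in> carrier U \<Longrightarrow> \<phi> u = \<psi> (enveloping_proj K Y C u)"
      "\<And>u. u \<in> carrier U \<Longrightarrow> enveloping_proj K Y C u \<in> carrier V"
    then show thesis by (rule that)
  qed
  have "carrier A \<subseteq> \<psi> ` carrier V"
    unfolding \<phi>_surj[symmetric] using factor proj by auto
  moreover have "\<psi> ` carrier V \<subseteq> carrier A"
    using \<psi> by (auto simp: algebra_hom_iff algebra_map_def)
  ultimately have \<psi>_surj: "\<psi> ` carrier V = carrier A" by blast
  have "\<phi> \<in> algebra_hom K U A \<and> \<phi> ` carrier U = carrier A \<and> \<psi> \<in> algebra_hom K V A \<and>
      \<psi> ` carrier V = carrier A \<and> (\<forall>u\<in>carrier U. \<phi> u = \<psi> (enveloping_proj K Y C u))"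
    by (intro conjI ballI \<phi> \<phi>_surj \<psi> \<psi>_surj factor)
  then show ?thesis
    unfolding Let_def Y_def[symmetric] U_def[symmetric] A_def[symmetric]
    by (intro conjI exI[of _ ?l] exI[of _ \<phi>] exI[of _ \<psi>] \<phi> \<phi>_surj)
      (simp_all only: C_def V_def, simp)
qed

end
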